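(* Let $\Omega\subset\mathbb{R}^d$ be convex and compact with non-empty interior, and let $\mathcal{H}$ be equal to the (fractional) Sobolev space $H^m=H^m(\Omega)$ with equivalent norms, where $m>d/2$. Suppose the design satisfies the norm-comparison property with constants $C_1$, $C_\epsilon$ and events $\Xi_\epsilon$. Let $g\in\mathcal{H}$ be such that: (i) there exist $C_g>0$ and $\delta\in(0,1]$ with $|\langle g,v\rangle_{\mathcal{H}}|\le C_g\|v\|_{L_2}^{\delta}\|v\|_{\mathcal{H}}^{1-\delta}$ for every $v\in\mathcal{H}$; (ii) for some $\tau\in(0,1]$ there exist $C_0>0$, $R_0>0$ such that for each $R\ge R_0$, $$\sup_{v\in\mathcal H:\ \|v\|_{\mathcal H}\le R\|v\|_{L_2}}\frac{\langle g,v\rangle_{\mathcal H}}{\|v\|_{L_2}}>C_0R^{1-\tau}.$$ Then for each $\epsilon>0$ there exist constants $A_1,A_2,A_3>0$ depending only on $C_0,C_1,C_g,C_\epsilon,R_0,\delta,\tau$ such that, on the event $\Xi_\epsilon$, for any $n$ and $\lambda$ satisfying $A_1n^{-2m/d}\le\lambda\le A_2$, $$\sup_{\|f\|_{\mathcal H}\le1}|\mathrm{BIAS}_f|\ \ge\ \begin{cases}A_3\lambda^{\frac{2\tau-2\delta+\delta^2-\delta^2\tau}{2\tau(1-\delta)}}&\text{if }\delta<1,\\ A_3\lambda&\text{if }\delta=1;\end{cases}$$ and in particular, if $\delta=\tau<1$, $$A_3\lambda^{\delta/2}\le\sup_{\|f\|_{\mathcal H}\le1}|\mathrm{BIAS}_f|\le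 A_4\lambda^{\delta/2}$$ for some $A_4$ depending only on $C_0,C_1,C_g,C_\epsilon,R_0,\delta$.
   Context: Setting: $K$ is a reproducing kernel on $\Omega\subset\mathbb{R}^d$ with reproducing kernel Hilbert space $\mathcal{H}$ (norm $\|\cdot\|_{\mathcal H}$, inner product $\langle\cdot,\cdot\rangle_{\mathcal H}$). For each $n$ there are design points $x_1,\dots,x_n\in\Omega$ (deterministic or random, may depend on $n$) and data $y_i=f(x_i)+e_i$, with $f\in\mathcal{H}$ and $e_1,e_2,\dots$ i.i.d. with mean zero and finite variance $\sigma^2$; the errors are independent of the design. Write $X=(x_1,\dots,x_n)^T$, $E=(e_1,\dots,e_n)^T$, $K(A,B)=(K(a_i,b_j))_{ij}$, $g(X)=(g(x_1),\dots,g(x_n))^T$, $f(X)=(f(x_1),\dots,f(x_n))^T$. The smoothing parameter is $\lambda>0$. The kernel ridge regression (KRR) estimator is $\hat f=\operatorname{argmin}_{v\in\mathcal{H}}\frac1n\sum_{i=1}^n(y_i-v(x_i))^2+\lambda\|v\|_{\mathcal{H}}^2$. Let $\mathbb{E}_E$ be the expectation with respect to $E$ only ($X$ held fixed). For fixed $g$, $X$ and $\lambda$, and each true function $f\in\mathcal H$, $$\mathrm{BIAS}_f:=\mathbb{E}_E\langle\hat f-f,g\rangle_{\mathcal H}=g^T(X)(K(X,X)+\lambda nI)^{-1}f(X)-\langle f,g\rangle_{\mathcal H}.$$ The same $g$, $X$, $\lambda$ are used for all $f$ in the supremum. Also $\|v\|_n^2=\frac1n\sum_{i=1}^n v(x_i)^2$,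 and $\|\cdot\|_{L_2}$ is the $L_2(\Omega)$ norm. Convention: $0/0=0$. Norm-comparison property of the design: $X$, if random, is independent of $E$; and there is $C_1>0$, and for each $\epsilon>0$ a $C_\epsilon>0$, all independent of $n$ and $X$, such that $\mathbb{P}(\Xi_\epsilon)\ge1-\epsilon$, where $\Xi_\epsilon$ (depending on $n$) is the event that, for all $v\in\mathcal H$, $\|v\|_{L_2}\le\max\{C_1\|v\|_n,C_\epsilon n^{-m/d}\|v\|_{\mathcal H}\}$ and $\|v\|_n\le\max\{C_1\|v\|_{L_2},C_\epsilon n^{-m/d}\|v\|_{\mathcal H}\}$ (for deterministic $X$ these inequalities hold unconditionally).
   Formalization: For δ=1 the constant A_3 may also depend on the fixed setting (d, m, Ω, K and the norm of H), since a bound uniform over all equivalent RKHS norms is false; A_1, A_2 and all constants for δ<1 depend only on the listed quantities. *)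

theory Defs
  imports "HOL-Probability.Probability"
begin

section \<open>Euclidean space of variable dimension\<close>

text \<open>
  The constants in the theorem must not depend on the dimension, so the dimension is a natural
  number \<open>d\<close> and not a type: the points of \<open>\<real>\<^sup>d\<close> are the elements of \<open>{..<d} \<rightarrow>\<^sub>E UNIV\<close>, which is
  the topological space \<open>powertop_real {..<d}\<close> and the underlying set of \<open>leb d\<close>.
\<close>

type_synonym point = "nat \<Rightarrow> real"

definition leb :: "nat \<Rightarrow> point measure" where
  "leb d = (\<Pi>\<^sub>M i\<in>{..<d}. lborel)"

definition dot :: "nat \<Rightarrow> point \<Rightarrow> point \<Rightarrow> real" where
  "dot d x y = (\<Sum>i<d. x i * y i)"

definition convex_pts :: "nat \<Rightarrow> point set \<Rightarrow> bool" where
  "convex_pts d \<Omega> \<longleftrightarrow>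
    (\<forall>x\<in>\<Omega>. \<forall>y\<in>\<Omega>. \<forall>t\<in>{0..1}. (\<lambda>i\<in>{..<d}. (1 - t) * x i + t * y i) \<in> \<Omega>)"

definition convex_body :: "nat \<Rightarrow> point set \<Rightarrow> bool" where
  "convex_body d \<Omega> \<longleftrightarrow>
    convex_pts d \<Omega> \<and> compactin (powertop_real {..<d}) \<Omega> \<and>
    powertop_real {..<d} interior_of \<Omega> \<noteq> {}"

definition L2_norm :: "nat \<Rightarrow> point set \<Rightarrow> (point \<Rightarrow> real) \<Rightarrow> real" where
  "L2_norm d \<Omega> v = sqrt (LINT x:\<Omega>|leb d. (v x)\<^sup>2)"


section \<open>Sobolev spaces\<close>

text \<open>
  Real functions on \<open>\<Omega>\<close> are represented by functions on the whole type that vanish off \<open>\<Omega>\<close>.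

  \<open>H\<^sup>m(\<Omega>)\<close> consists of the restrictions to \<open>\<Omega>\<close> of the elements \<open>F\<close> of \<open>H\<^sup>m(\<real>\<^sup>d)\<close>, with the
  quotient norm, and \<open>F\<close> is given by its unitary Fourier transform \<open>\<phi>\<close>. The definitions are meant
  for \<open>m > d/2\<close> only: then \<open>(1 + \<bar>\<xi>\<bar>\<^sup>2)\<^sup>-\<^sup>m\<close> is integrable, so \<open>\<phi>\<close> is integrable and the inversion
  integral is the continuous representative of \<open>F\<close>, which makes the restriction to \<open>\<Omega>\<close> pointwise.
\<close>

definition sobolev_ext :: "nat \<Rightarrow> real \<Rightarrow> point set \<Rightarrow> (point \<Rightarrow> real) \<Rightarrow> (point \<Rightarrow> complex) \<Rightarrow> bool" where
  "sobolev_ext d m \<Omega> f \<phi> \<longleftrightarrow>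
    \<phi> \<in> borel_measurable (leb d) \<and>
    integrable (leb d) (\<lambda>\<xi>. (1 + dot d \<xi> \<xi>) powr m * (cmod (\<phi> \<xi>))\<^sup>2) \<and>
    (\<forall>x\<in>\<Omega>. complex_of_real (f x) =
       complex_of_real ((2 * pi) powr (- (real d / 2))) * (LINT \<xi>|leb d. \<phi> \<xi> * cis (dot d x \<xi>)))"

definition sobolev_space :: "nat \<Rightarrow> real \<Rightarrow> point set \<Rightarrow> (point \<Rightarrow> real) set" where
  "sobolev_space d m \<Omega> = {f. (\<forall>x. x \<notin> \<Omega> \<longrightarrow> f x = 0) \<and> (\<exists>\<phi>. sobolev_ext d m \<Omega> f \<phi>)}"

definition sobolev_norm :: "nat \<Rightarrow> real \<Rightarrow> point set \<Rightarrow> (point \<Rightarrow> real) \<Rightarrow> real" where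
  "sobolev_norm d m \<Omega> f =
    Inf {sqrt (LINT \<xi>|leb d. (1 + dot d \<xi> \<xi>) powr m * (cmod (\<phi> \<xi>))\<^sup>2) | \<phi>. sobolev_ext d m \<Omega> f \<phi>}"


section \<open>Reproducing kernel Hilbert spaces\<close>

definition hnorm :: "(('x \<Rightarrow> real) \<Rightarrow> ('x \<Rightarrow> real) \<Rightarrow> real) \<Rightarrow> ('x \<Rightarrow> real) \<Rightarrow> real" where
  "hnorm ip v = sqrt (ip v v)"

locale rkhs =
  fixes \<Omega> :: "'x set"
    and K :: "'x \<Rightarrow> 'x \<Rightarrow> real"
    and H :: "('x \<Rightarrow> real) set"
    and ip :: "('x \<Rightarrow> real) \<Rightarrow> ('x \<Rightarrow> real) \<Rightarrow> real"
  assumes off_domain: "\<And>u x. u \<in> H \<Longrightarrow> x \<notin> \<Omega> \<Longrightarrow> u x = 0"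
    and zero_mem: "(\<lambda>x. 0) \<in> H"
    and add_mem: "\<And>u v. u \<in> H \<Longrightarrow> v \<in> H \<Longrightarrow> (\<lambda>x. u x + v x) \<in> H"
    and scale_mem: "\<And>c u. u \<in> H \<Longrightarrow> (\<lambda>x. c * u x) \<in> H"
    and ip_commute: "\<And>u v. u \<in> H \<Longrightarrow> v \<in> H \<Longrightarrow> ip u v = ip v u"
    and ip_add_left: "\<And>u v w. u \<in> H \<Longrightarrow> v \<in> H \<Longrightarrow> w \<in> H \<Longrightarrow>
          ip (\<lambda>x. u x + v x) w = ip u w + ip v w"
    and ip_scale_left: "\<And>c u v. u \<in> H \<Longrightarrow> v \<in> H \<Longrightarrow> ip (\<lambda>x. c * u x) v = c * ip u v"
    and ip_nonneg: "\<And>u. u \<in> H \<Longrightarrow> 0 \<le> ip u u"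
    and ip_eq_zero: "\<And>u. u \<in> H \<Longrightarrow> ip u u = 0 \<Longrightarrow> u = (\<lambda>x. 0)"
    and complete: "\<And>s :: nat \<Rightarrow> 'x \<Rightarrow> real. (\<And>i. s i \<in> H) \<Longrightarrow>
          (\<forall>e>0. \<exists>N. \<forall>i\<ge>N. \<forall>j\<ge>N. hnorm ip (\<lambda>x. s i x - s j x) < e) \<Longrightarrow>
          \<exists>l\<in>H. (\<lambda>i. hnorm ip (\<lambda>x. s i x - l x)) \<longlonglongrightarrow> 0"
    and kernel_mem: "\<And>x. x \<in> \<Omega> \<Longrightarrow> (\<lambda>z. if z \<in> \<Omega> then K z x else 0) \<in> H"
    and reproducing: "\<And>u x. u \<in> H \<Longrightarrow> x \<in> \<Omega> \<Longrightarrow>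
          ip u (\<lambda>z. if z \<in> \<Omega> then K z x else 0) = u x"

definition sobolev_rkhs ::
  "nat \<Rightarrow> real \<Rightarrow> point set \<Rightarrow> (point \<Rightarrow> point \<Rightarrow> real) \<Rightarrow> (point \<Rightarrow> real) set \<Rightarrow>
   ((point \<Rightarrow> real) \<Rightarrow> (point \<Rightarrow> real) \<Rightarrow> real) \<Rightarrow> bool" where
  "sobolev_rkhs d m \<Omega> K H ip \<longleftrightarrow>
    1 \<le> d \<and> real d / 2 < m \<and> convex_body d \<Omega> \<and> rkhs \<Omega> K H ip \<and>
    H = sobolev_space d m \<Omega> \<and>
    (\<exists>a>0. \<exists>b>0. \<forall>v\<in>H. a * sobolev_norm d m \<Omega> v \<le> hnorm ip v \<and>
                       hnorm ip v \<le> b * sobolev_norm d m \<Omega> v)"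


section \<open>Kernel ridge regression\<close>

definition emp_norm :: "nat \<Rightarrow> (nat \<Rightarrow> 'x) \<Rightarrow> ('x \<Rightarrow> real) \<Rightarrow> real" where
  "emp_norm n x v = sqrt (1 / real n * (\<Sum>i<n. (v (x i))\<^sup>2))"

definition krr ::
  "('x \<Rightarrow> real) set \<Rightarrow> (('x \<Rightarrow> real) \<Rightarrow> ('x \<Rightarrow> real) \<Rightarrow> real) \<Rightarrow> nat \<Rightarrow> real \<Rightarrow> (nat \<Rightarrow> 'x) \<Rightarrow>
   (nat \<Rightarrow> real) \<Rightarrow> 'x \<Rightarrow> real" where
  "krr H ip n lam x y =
    arg_min (\<lambda>v. 1 / real n * (\<Sum>i<n. (y i - v (x i))\<^sup>2) + lam * (hnorm ip v)\<^sup>2) (\<lambda>v. v \<in> H)"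

text \<open>
  The design \<open>x\<close> is a fixed argument here, so the integral over the sample space is the expectation
  with respect to the errors \<open>e\<close> only.
\<close>

definition bias ::
  "'w measure \<Rightarrow> (nat \<Rightarrow> 'w \<Rightarrow> real) \<Rightarrow> ('x \<Rightarrow> real) set \<Rightarrow>
   (('x \<Rightarrow> real) \<Rightarrow> ('x \<Rightarrow> real) \<Rightarrow> real) \<Rightarrow> ('x \<Rightarrow> real) \<Rightarrow> nat \<Rightarrow> real \<Rightarrow> (nat \<Rightarrow> 'x) \<Rightarrow>
   ('x \<Rightarrow> real) \<Rightarrow> real" where
  "bias M e H ip g n lam x f =
    (LINT w|M. ip (\<lambda>z. krr H ip n lam x (\<lambda>i. f (x i) + e i w) z - f z) g)"

definition sup_bias ::
  "'w measure \<Rightarrow> (nat \<Rightarrow> 'w \<Rightarrow> real) \<Rightarrow> ('x \<Rightarrow> real) set \<Rightarrow>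
   (('x \<Rightarrow> real) \<Rightarrow> ('x \<Rightarrow> real) \<Rightarrow> real) \<Rightarrow> ('x \<Rightarrow> real) \<Rightarrow> nat \<Rightarrow> real \<Rightarrow> (nat \<Rightarrow> 'x) \<Rightarrow> ereal" where
  "sup_bias M e H ip g n lam x =
    (SUP f\<in>{f \<in> H. hnorm ip f \<le> 1}. ereal \<bar>bias M e H ip g n lam x f\<bar>)"


section \<open>Errors and design\<close>

definition iid_errors :: "'w measure \<Rightarrow> (nat \<Rightarrow> 'w \<Rightarrow> real) \<Rightarrow> real \<Rightarrow> bool" where
  "iid_errors M e \<sigma> \<longleftrightarrow>
    prob_space M \<and>
    prob_space.indep_vars M (\<lambda>_. borel) e UNIV \<and>
    (\<forall>i. distr M borel (e i) = distr M borel (e 0)) \<and>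
    (\<forall>i. integrable M (\<lambda>w. (e i w)\<^sup>2) \<and> prob_space.expectation M (e i) = 0 \<and>
         prob_space.variance M (e i) = \<sigma>\<^sup>2)"

text \<open>
  \<open>X n 0, \<dots>, X n (n - 1)\<close> are the design points for sample size \<open>n\<close>; a deterministic design is the
  case of constant random variables.
\<close>

definition design ::
  "'w measure \<Rightarrow> (nat \<Rightarrow> 'w \<Rightarrow> real) \<Rightarrow> nat \<Rightarrow> point set \<Rightarrow> (nat \<Rightarrow> nat \<Rightarrow> 'w \<Rightarrow> point) \<Rightarrow> bool" where
  "design M e d \<Omega> X \<longleftrightarrow>
    (\<forall>n. (\<forall>i<n. X n i \<in> measurable M (leb d) \<and> (\<forall>w\<in>space M. X n i w \<in> \<Omega>)) \<and>
         prob_space.indep_set M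
           (sets (vimage_algebra (space M) (\<lambda>w. \<lambda>i\<in>{..<n}. X n i w) (\<Pi>\<^sub>M i\<in>{..<n}. leb d)))
           (sets (vimage_algebra (space M) (\<lambda>w. \<lambda>i\<in>{..<n}. e i w) (\<Pi>\<^sub>M i\<in>{..<n}. borel))))"

definition Xi_event ::
  "'w measure \<Rightarrow> nat \<Rightarrow> real \<Rightarrow> point set \<Rightarrow> (point \<Rightarrow> real) set \<Rightarrow>
   ((point \<Rightarrow> real) \<Rightarrow> (point \<Rightarrow> real) \<Rightarrow> real) \<Rightarrow> (nat \<Rightarrow> nat \<Rightarrow> 'w \<Rightarrow> point) \<Rightarrow>
   real \<Rightarrow> real \<Rightarrow> nat \<Rightarrow> 'w set" where
  "Xi_event M d m \<Omega> H ip X C1 C n =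
    {w \<in> space M. \<forall>v\<in>H.
       L2_norm d \<Omega> v \<le> max (C1 * emp_norm n (\<lambda>i. X n i w) v)
                            (C * real n powr (- (m / real d)) * hnorm ip v) \<and>
       emp_norm n (\<lambda>i. X n i w) v \<le> max (C1 * L2_norm d \<Omega> v)
                            (C * real n powr (- (m / real d)) * hnorm ip v)}"

definition norm_comparison ::
  "'w measure \<Rightarrow> nat \<Rightarrow> real \<Rightarrow> point set \<Rightarrow> (point \<Rightarrow> real) set \<Rightarrow>
   ((point \<Rightarrow> real) \<Rightarrow> (point \<Rightarrow> real) \<Rightarrow> real) \<Rightarrow> (nat \<Rightarrow> nat \<Rightarrow> 'w \<Rightarrow> point) \<Rightarrow>
   real \<Rightarrow> (real \<Rightarrow> real) \<Rightarrow> bool" where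
  "norm_comparison M d m \<Omega> H ip X C1 C \<longleftrightarrow>
    0 < C1 \<and>
    (\<forall>\<epsilon>>0. 0 < C \<epsilon> \<and> (\<forall>n\<ge>1. 1 - \<epsilon> \<le> measure M (Xi_event M d m \<Omega> H ip X C1 (C \<epsilon>) n)))"


section \<open>Conditions on the functional\<close>

definition interpolation_bound ::
  "nat \<Rightarrow> point set \<Rightarrow> (point \<Rightarrow> real) set \<Rightarrow> ((point \<Rightarrow> real) \<Rightarrow> (point \<Rightarrow> real) \<Rightarrow> real) \<Rightarrow>
   (point \<Rightarrow> real) \<Rightarrow> real \<Rightarrow> real \<Rightarrow> bool" where
  "interpolation_bound d \<Omega> H ip g Cg \<delta> \<longleftrightarrow>
    (\<forall>v\<in>H. \<bar>ip g v\<bar> \<le> Cg * L2_norm d \<Omega> v powr \<delta> * hnorm ip v powr (1 - \<delta>))"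

definition growth_bound ::
  "nat \<Rightarrow> point set \<Rightarrow> (point \<Rightarrow> real) set \<Rightarrow> ((point \<Rightarrow> real) \<Rightarrow> (point \<Rightarrow> real) \<Rightarrow> real) \<Rightarrow>
   (point \<Rightarrow> real) \<Rightarrow> real \<Rightarrow> real \<Rightarrow> real \<Rightarrow> bool" where
  "growth_bound d \<Omega> H ip g C0 R0 \<tau> \<longleftrightarrow>
    (\<forall>R\<ge>R0. (SUP v\<in>{v \<in> H. hnorm ip v \<le> R * L2_norm d \<Omega> v}. ereal (ip g v / L2_norm d \<Omega> v))
             > ereal (C0 * R powr (1 - \<tau>)))"

end

theory Submission
  imports Defs
begin

text \<open>
  The proof turns the supremum of the bias into the norm of a single function. Let
  \<open>B(u,v) = \<langle>u,v\<rangle>\<^sub>n + \<lambda> \<langle>u,v\<rangle>\<^sub>\<H>\<close> be the bilinear form behind the penalised least squares criterion, and let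
  \<open>h \<in> \<H>\<close> represent \<open>\<lambda> \<langle>g,\<cdot>\<rangle>\<close> with respect to it: \<open>B(h,v) = \<lambda> \<langle>g,v\<rangle>\<close> for all \<open>v\<close>. This \<open>h\<close> is
  the residual that ridge regression from noiseless data leaves of \<open>g\<close>. Since \<open>B\<close> is symmetric,
  testing the normal equations of the estimator with \<open>h\<close> gives \<open>BIAS\<^sub>f = - \<langle>f,h\<rangle>\<close>, so the supremum over the unit ball is \<open>\<parallel>h\<parallel>\<close>
  (\<open>sup_bias_eq_hnorm\<close>).

  The norm of \<open>h\<close> is compared with its energy \<open>S = B(h,h)\<^sup>1\<^sup>/\<^sup>2\<close>. The choice of \<open>A1\<close> makes the remainder
  \<open>C\<^sub>\<epsilon> n\<^sup>-\<^sup>m\<^sup>/\<^sup>d \<parallel>v\<parallel>\<close> in the norm comparison at most \<open>\<lambda>\<^sup>1\<^sup>/\<^sup>2 \<parallel>v\<parallel>\<close>, which an energy absorbs. Two inequalities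
  follow:

  \<^item> By (i), \<open>S\<^sup>2 = \<lambda> \<langle>g,h\<rangle>\<close> is at most a constant times \<open>\<lambda> S\<^sup>\<delta> \<parallel>h\<parallel>\<^sup>1\<^sup>-\<^sup>\<delta>\<close> (\<open>residual_energy_upper\<close>).

  \<^item> By (ii) with \<open>R = \<lambda>\<^sup>-\<^sup>1\<^sup>/\<^sup>2\<close>, there is a \<open>v\<close> with energy at most of the order of \<open>\<parallel>v\<parallel>\<^sub>L\<^sub>2\<close> and with
    \<open>B(h,v) = \<lambda> \<langle>g,v\<rangle>\<close> at least of the order \<open>\<lambda>\<^sup>(\<^sup>1\<^sup>+\<^sup>\<tau>\<^sup>)\<^sup>/\<^sup>2 \<parallel>v\<parallel>\<^sub>L\<^sub>2\<close>; by Cauchy--Schwarz \<open>S\<close> is at least of the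
    order \<open>\<lambda>\<^sup>(\<^sup>1\<^sup>+\<^sup>\<tau>\<^sup>)\<^sup>/\<^sup>2\<close> (\<open>residual_energy_lower\<close>).

  For \<open>\<delta> < 1\<close> the first inequality can be solved for \<open>\<parallel>h\<parallel>\<close> in both directions. With \<open>\<lambda>\<^sup>1\<^sup>/\<^sup>2 \<parallel>h\<parallel> \<le> S\<close> it
  yields the upper bound of order \<open>\<lambda>\<^sup>\<delta>\<^sup>/\<^sup>2\<close>, and with the lower bound for \<open>S\<close> it yields a lower bound with
  exponent \<open>(2\<tau> - \<delta> - \<delta>\<tau>) / (2 (1 - \<delta>))\<close>. Conditions (i) and (ii) together force \<open>\<delta> \<le> \<tau>\<close>, and then this
  exponent does not exceed the claimed one, while \<open>\<lambda> \<le> 1\<close>.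

  For \<open>\<delta> = 1\<close> the norm of \<open>h\<close> disappears from the first inequality. Instead, point evaluations are
  bounded on \<open>\<H>\<close> by the Sobolev embedding, say \<open>\<bar>v(z)\<bar> \<le> b \<parallel>v\<parallel>\<close>, so
  \<open>\<lambda> \<parallel>g\<parallel>\<^sup>2 = B(h,g) \<le> (b\<^sup>2 + \<lambda>) \<parallel>h\<parallel> \<parallel>g\<parallel>\<close>; and (ii) bounds \<open>\<parallel>g\<parallel>\<close> from below. The constant \<open>b\<close> is the reason
  why the constant here is chosen after the space.
\<close>

section \<open>Inner product calculus and penalised equations\<close>

context rkhs
begin

lemma ip_add_right: "u \<in> H \<Longrightarrow> v \<in> H \<Longrightarrow> w \<in> H \<Longrightarrow> ip w (\<lambda>x. u x + v x) = ip w u + ip w v"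
  using ip_add_left[of u v w] ip_commute add_mem by simp

lemma ip_scale_right: "u \<in> H \<Longrightarrow> v \<in> H \<Longrightarrow> ip v (\<lambda>x. c * u x) = c * ip v u"
  using ip_scale_left[of u v c] ip_commute scale_mem by simp

lemma diff_mem: "u \<in> H \<Longrightarrow> v \<in> H \<Longrightarrow> (\<lambda>x. u x - v x) \<in> H"
  using add_mem[of u "\<lambda>x. (-1) * v x"] scale_mem[of v "-1"] by simp

lemma ip_diff_left:
  assumes "u \<in> H" "v \<in> H" "w \<in> H"
  shows "ip (\<lambda>x. u x - v x) w = ip u w - ip v w"
  using ip_add_left[of u "\<lambda>x. (-1) * v x" w] ip_scale_left[of v w "-1"] scale_mem[of v "-1"] assms
  by simp

lemma ip_diff_right:
  assumes "u \<in> H" "v \<in> H" "w \<in> H"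
  shows "ip w (\<lambda>x. u x - v x) = ip w u - ip w v"
  using ip_diff_left[OF assms] ip_commute diff_mem assms by simp

lemma hnorm_nonneg: "u \<in> H \<Longrightarrow> 0 \<le> hnorm ip u"
  by (simp add: hnorm_def ip_nonneg)

lemma hnorm_square: "u \<in> H \<Longrightarrow> (hnorm ip u)\<^sup>2 = ip u u"
  by (simp add: hnorm_def ip_nonneg)

lemma hnorm_scale: "u \<in> H \<Longrightarrow> hnorm ip (\<lambda>x. c * u x) = \<bar>c\<bar> * hnorm ip u"
  by (simp add: hnorm_def ip_scale_left ip_scale_right scale_mem real_sqrt_mult mult.assoc[symmetric])

lemma cauchy_schwarz:
  assumes "u \<in> H" "v \<in> H"
  shows "\<bar>ip u v\<bar> \<le> hnorm ip u * hnorm ip v"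
proof (cases "ip v v = 0")
  case True
  then have "v = (\<lambda>x. 0)" using ip_eq_zero assms by blast
  then have "ip u v = 0" using ip_scale_right[of v u 0] assms by simp
  then show ?thesis using hnorm_nonneg assms by simp
next
  case False
  then have pos: "0 < ip v v" using ip_nonneg assms by (simp add: order_less_le)
  define c where "c = ip u v / ip v v"
  have cv: "(\<lambda>x. c * v x) \<in> H" by (rule scale_mem) fact
  have "0 \<le> ip (\<lambda>x. u x - c * v x) (\<lambda>x. u x - c * v x)"
    by (intro ip_nonneg diff_mem assms cv)
  also have "\<dots> = ip u u - 2 * c * ip u v + c\<^sup>2 * ip v v"
    using assms cv by (simp add: ip_diff_left ip_diff_right diff_mem ip_scale_left ip_scale_right
        ip_commute[of v u] power2_eq_square algebra_simps)
  also have "\<dots> = ip u u - (ip u v)\<^sup>2 / ip v v"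
    using pos by (simp add: c_def field_simps power2_eq_square)
  finally have "(ip u v)\<^sup>2 \<le> ip u u * ip v v" using pos by (simp add: field_simps)
  then have "sqrt ((ip u v)\<^sup>2) \<le> sqrt (ip u u * ip v v)" by (rule real_sqrt_le_mono)
  then show ?thesis by (simp add: hnorm_def real_sqrt_mult)
qed

lemma ex_weighted_evaluations:
  fixes n :: nat
  assumes "\<And>i. i < n \<Longrightarrow> x i \<in> \<Omega>"
  shows "\<exists>w\<in>H. \<forall>v\<in>H. ip w v = (\<Sum>i<n. c i * v (x i))"
  using assms
proof (induction n)
  case 0
  have "ip (\<lambda>x. 0) v = 0" if "v \<in> H" for v
    using ip_scale_left[of v v 0] that by simp
  then show ?case using zero_mem by auto
next
  case (Suc n)
  then obtain w where w: "w \<in> H" "\<And>v. v \<in> H \<Longrightarrow> ip w v = (\<Sum>i<n. c i * v (x i))" by auto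
  define k where "k = (\<lambda>z. if z \<in> \<Omega> then K z (x n) else 0)"
  have k: "k \<in> H" "\<And>v. v \<in> H \<Longrightarrow> ip k v = v (x n)"
    using kernel_mem[of "x n"] reproducing[of _ "x n"] Suc.prems[of n] ip_commute
    by (auto simp: k_def)
  have ck: "(\<lambda>z. c n * k z) \<in> H" by (rule scale_mem) fact
  show ?case
    by (rule bexI[OF _ add_mem[OF w(1) ck]]) (simp add: w k ck ip_add_left ip_scale_left)
qed

text \<open>
  Each design point changes the operator by the rank-one term \<open>r K\<^sub>x \<otimes> K\<^sub>x\<close>, so the equation can be solved
  by adding the points one at a time with the Sherman--Morrison formula.
\<close>

lemma ex_regularised_solution:
  fixes n :: nat
  assumes "0 < lam" "0 \<le> r" "\<And>i. i < n \<Longrightarrow> x i \<in> \<Omega>" "w \<in> H"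
  shows "\<exists>u\<in>H. \<forall>v\<in>H. r * (\<Sum>i<n. u (x i) * v (x i)) + lam * ip u v = ip w v"
  using assms(3,4)
proof (induction n arbitrary: w)
  case 0
  show ?case
    by (rule bexI[OF _ scale_mem[OF 0(2), of "1 / lam"]])
      (use assms(1) ip_scale_left[OF 0(2), of _ "1 / lam"] in simp)
next
  case (Suc n)
  define F where "F = (\<lambda>u v. r * (\<Sum>i<n. u (x i) * v (x i)) + lam * ip u v)"
  define k where "k = (\<lambda>z. if z \<in> \<Omega> then K z (x n) else 0)"
  have k: "k \<in> H" "\<And>v. v \<in> H \<Longrightarrow> ip k v = v (x n)"
    using kernel_mem[of "x n"] reproducing[of _ "x n"] Suc.prems(1)[of n] ip_commute
    by (auto simp: k_def)
  obtain a where a: "a \<in> H" "\<And>v. v \<in> H \<Longrightarrow> F a v = ip w v"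
    using Suc.IH[of w] Suc.prems by (auto simp: F_def)
  obtain b where b: "b \<in> H" "\<And>v. v \<in> H \<Longrightarrow> F b v = v (x n)"
    using Suc.IH[of k] Suc.prems k by (auto simp: F_def)
  have "b (x n) = F b b" using b by simp
  then have b_nonneg: "0 \<le> b (x n)"
    using assms(1,2) ip_nonneg[OF b(1)] by (simp add: F_def sum_nonneg)
  (* The solution has the form a - c b; the new evaluation term contributes
     r (a(x_n) - c b(x_n)) K_{x_n}, and c is chosen to cancel it against -c K_{x_n}. *)
  define c where "c = r * a (x n) / (1 + r * b (x n))"
  have den: "0 < 1 + r * b (x n)" using b_nonneg assms(2) by (simp add: add_pos_nonneg)
  then have "c * (1 + r * b (x n)) = r * a (x n)" by (simp add: c_def)
  then have c: "r * (a (x n) - c * b (x n)) = c" by (simp add: algebra_simps)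
  have cb: "(\<lambda>z. c * b z) \<in> H" by (rule scale_mem) fact
  have "r * (\<Sum>i<Suc n. (a (x i) - c * b (x i)) * v (x i)) + lam * ip (\<lambda>z. a z - c * b z) v = ip w v"
    if v: "v \<in> H" for v
  proof -
    have "r * (\<Sum>i<Suc n. (a (x i) - c * b (x i)) * v (x i)) + lam * ip (\<lambda>z. a z - c * b z) v
        = F a v - c * F b v + r * (a (x n) - c * b (x n)) * v (x n)"
      using v by (simp add: F_def ip_diff_left ip_scale_left a b cb algebra_simps sum_subtractf
          sum_distrib_left)
    also have "\<dots> = ip w v" using v by (simp add: c a b)
    finally show ?thesis .
  qed
  then show ?case by (intro bexI[OF _ diff_mem[OF a(1) cb]]) auto
qed

end


section \<open>Ridge regression and the residual representing the bias\<close>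

text \<open>
  The polarisation of the penalised empirical norm \<open>\<parallel>v\<parallel>\<^sub>n\<^sup>2 + \<lambda> \<parallel>v\<parallel>\<^sub>\<H>\<^sup>2\<close>.
\<close>

definition reg_form ::
  "(('x \<Rightarrow> real) \<Rightarrow> ('x \<Rightarrow> real) \<Rightarrow> real) \<Rightarrow> nat \<Rightarrow> real \<Rightarrow> (nat \<Rightarrow> 'x) \<Rightarrow>
   ('x \<Rightarrow> real) \<Rightarrow> ('x \<Rightarrow> real) \<Rightarrow> real" where
  "reg_form ip n lam x u v = 1 / real n * (\<Sum>i<n. u (x i) * v (x i)) + lam * ip u v"

context rkhs
begin

lemma reg_form_diff_left:
  assumes "u \<in> H" "v \<in> H" "w \<in> H"
  shows "reg_form ip n lam x (\<lambda>z. u z - v z) w = reg_form ip n lam x u w - reg_form ip n lam x v w"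
  using assms by (simp add: reg_form_def ip_diff_left algebra_simps sum_subtractf diff_divide_distrib)

lemma reg_form_commute:
  "u \<in> H \<Longrightarrow> v \<in> H \<Longrightarrow> reg_form ip n lam x u v = reg_form ip n lam x v u"
  by (simp add: reg_form_def ip_commute[of u v] mult.commute)

lemma reg_form_eq:
  "u \<in> H \<Longrightarrow> reg_form ip n lam x u u = (emp_norm n x u)\<^sup>2 + lam * (hnorm ip u)\<^sup>2"
  unfolding hnorm_square by (simp add: reg_form_def emp_norm_def sum_nonneg power2_eq_square[symmetric])

lemma ip_le_reg_form:
  "u \<in> H \<Longrightarrow> lam * ip u u \<le> reg_form ip n lam x u u"
  by (simp add: reg_form_def sum_nonneg)

lemma reg_form_le:
  assumes "u \<in> H" "v \<in> H" "0 \<le> lam"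
  shows "\<bar>reg_form ip n lam x u v\<bar>
    \<le> emp_norm n x u * emp_norm n x v + lam * (hnorm ip u * hnorm ip v)"
proof -
  have "\<bar>\<Sum>i<n. u (x i) * v (x i)\<bar> \<le> (\<Sum>i<n. \<bar>u (x i)\<bar> * \<bar>v (x i)\<bar>)"
    by (rule order_trans[OF sum_abs]) (simp add: abs_mult)
  also have "\<dots> \<le> sqrt (\<Sum>i<n. (u (x i))\<^sup>2) * sqrt (\<Sum>i<n. (v (x i))\<^sup>2)"
    using L2_set_mult_ineq[of "\<lambda>i. u (x i)" "\<lambda>i. v (x i)" "{..<n}"] by (simp add: L2_set_def)
  finally have "1 / real n * \<bar>\<Sum>i<n. u (x i) * v (x i)\<bar>
      \<le> 1 / real n * (sqrt (\<Sum>i<n. (u (x i))\<^sup>2) * sqrt (\<Sum>i<n. (v (x i))\<^sup>2))"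
    by (rule mult_left_mono) simp
  also have "\<dots> = emp_norm n x u * emp_norm n x v"
    by (simp add: emp_norm_def real_sqrt_mult real_sqrt_divide)
  finally have 1: "\<bar>1 / real n * (\<Sum>i<n. u (x i) * v (x i))\<bar> \<le> emp_norm n x u * emp_norm n x v"
    by (simp add: abs_mult)
  have 2: "\<bar>lam * ip u v\<bar> \<le> lam * (hnorm ip u * hnorm ip v)"
    using cauchy_schwarz[OF assms(1,2)] assms(3) by (simp add: abs_mult mult_left_mono)
  show ?thesis using 1 2 unfolding reg_form_def by linarith
qed

text \<open>
  The criterion exceeds its value at the solution \<open>u\<close> of the normal equations by the energy of \<open>v - u\<close>.
  Hence \<open>u\<close> is the only minimiser, and the choice made by \<open>arg_min\<close> is determined.
\<close>

lemma krr_normal_equation: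
  assumes "0 < lam" "\<And>i. i < n \<Longrightarrow> x i \<in> \<Omega>"
  shows "krr H ip n lam x y \<in> H"
    and "v \<in> H \<Longrightarrow> reg_form ip n lam x (krr H ip n lam x y) v = 1 / real n * (\<Sum>i<n. y i * v (x i))"
proof -
  define J where "J = (\<lambda>v. 1 / real n * (\<Sum>i<n. (y i - v (x i))\<^sup>2) + lam * (hnorm ip v)\<^sup>2)"
  obtain w where w: "w \<in> H" "\<And>v. v \<in> H \<Longrightarrow> ip w v = (\<Sum>i<n. 1 / real n * y i * v (x i))"
    using ex_weighted_evaluations[of n x "\<lambda>i. 1 / real n * y i"] assms by blast
  obtain u where u: "u \<in> H" and "\<And>v. v \<in> H \<Longrightarrow> reg_form ip n lam x u v = ip w v"
    using ex_regularised_solution[of lam "1 / real n" n x w] assms w by (auto simp: reg_form_def)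
  then have uv: "reg_form ip n lam x u v = 1 / real n * (\<Sum>i<n. y i * v (x i))" if "v \<in> H" for v
    using w that by (simp add: sum_distrib_left mult.assoc)
  have J: "J v = J u + reg_form ip n lam x (\<lambda>z. v z - u z) (\<lambda>z. v z - u z)" if v: "v \<in> H" for v
  proof -
    have s: "(\<Sum>i<n. (y i - v (x i))\<^sup>2) = (\<Sum>i<n. (y i - u (x i))\<^sup>2)
        - 2 * (\<Sum>i<n. y i * (v (x i) - u (x i))) + 2 * (\<Sum>i<n. u (x i) * (v (x i) - u (x i)))
        + (\<Sum>i<n. (v (x i) - u (x i)) * (v (x i) - u (x i)))"
      unfolding sum_distrib_left sum_subtractf[symmetric] sum.distrib[symmetric]
      by (rule sum.cong) (auto simp: power2_eq_square algebra_simps)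
    have i: "ip v v = ip u u + 2 * ip u (\<lambda>z. v z - u z) + ip (\<lambda>z. v z - u z) (\<lambda>z. v z - u z)"
      using v u by (simp add: ip_diff_left ip_diff_right diff_mem ip_commute[of v u])
    have e: "1 / real n * (\<Sum>i<n. u (x i) * (v (x i) - u (x i))) + lam * ip u (\<lambda>z. v z - u z)
        = 1 / real n * (\<Sum>i<n. y i * (v (x i) - u (x i)))"
      using uv[OF diff_mem[OF v u]] by (simp add: reg_form_def)
    show ?thesis unfolding J_def reg_form_def using u v
      unfolding hnorm_square[OF u] hnorm_square[OF v] s i using e by (simp add: algebra_simps)
  qed
  have pos: "reg_form ip n lam x v v \<ge> lam * ip v v" if "v \<in> H" for v
    using ip_le_reg_form that .
  have nonneg: "0 \<le> lam * ip v v" if "v \<in> H" for v using assms(1) ip_nonneg[OF that] by simp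
  have min: "\<not> J v < J u" if "v \<in> H" for v
    using J[OF that] pos[OF diff_mem[OF that u]] nonneg[OF diff_mem[OF that u]] by linarith
  have "arg_min J (\<lambda>v. v \<in> H) = u"
  proof (rule arg_minI[of "\<lambda>v. v \<in> H" u J "\<lambda>v. v = u"])
    fix v assume v: "v \<in> H" "\<forall>y. y \<in> H \<longrightarrow> \<not> J y < J v"
    have vu: "(\<lambda>z. v z - u z) \<in> H" using v u diff_mem by blast
    have "lam * ip (\<lambda>z. v z - u z) (\<lambda>z. v z - u z) \<le> 0"
      using J[OF v(1)] pos[OF vu] v(2) u by force
    then have "ip (\<lambda>z. v z - u z) (\<lambda>z. v z - u z) = 0"
      using assms(1) ip_nonneg[OF vu] by (simp add: mult_le_0_iff)
    then have "(\<lambda>z. v z - u z) = (\<lambda>z. 0)" using ip_eq_zero vu by blast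
    then show "v = u" by (metis eq_iff_diff_eq_0 ext)
  qed (use u min in auto)
  then have k: "krr H ip n lam x y = u" by (simp add: krr_def J_def)
  show "krr H ip n lam x y \<in> H" using k u by simp
  show "reg_form ip n lam x (krr H ip n lam x y) v = 1 / real n * (\<Sum>i<n. y i * v (x i))" if "v \<in> H"
    using uv[OF that] k by simp
qed

text \<open>
  Testing the normal equations with \<open>h\<close> and using the symmetry of the form shows that the inner product
  of the estimation error with \<open>g\<close> is \<open>(n \<lambda>)\<^sup>-\<^sup>1 \<Sum> e\<^sub>i h(x\<^sub>i) - \<langle>f,h\<rangle>\<close>. The noise enters linearly, and its
  mean is zero.
\<close>

lemma bias_eq_ip:
  assumes "iid_errors M e \<sigma>" "0 < lam" "\<And>i. i < n \<Longrightarrow> x i \<in> \<Omega>" "f \<in> H" "g \<in> H" "h \<in> H"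
    and h: "\<And>v. v \<in> H \<Longrightarrow> reg_form ip n lam x h v = lam * ip g v"
  shows "bias M e H ip g n lam x f = - ip f h"
proof -
  interpret prob_space M using assms(1) unfolding iid_errors_def by blast
  have e: "integrable M (e i)" "expectation (e i) = 0" for i
  proof -
    have "indep_vars (\<lambda>_. borel) e UNIV" "integrable M (\<lambda>w. (e i w)\<^sup>2)"
      using assms(1) unfolding iid_errors_def by blast+
    moreover from this(1) have "random_variable borel (e i)" by (simp add: indep_vars_def)
    ultimately show "integrable M (e i)" by (metis square_integrable_imp_integrable)
    show "expectation (e i) = 0" using assms(1) unfolding iid_errors_def by blast
  qed
  have *: "ip (\<lambda>z. krr H ip n lam x (\<lambda>i. f (x i) + e i w) z - f z) g
      = (1 / (lam * real n)) * (\<Sum>i<n. h (x i) * e i w) - ip f h" for w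
  proof -
    define k where "k = krr H ip n lam x (\<lambda>i. f (x i) + e i w)"
    have k: "k \<in> H" "\<And>v. v \<in> H \<Longrightarrow> reg_form ip n lam x k v = 1 / real n * (\<Sum>i<n. (f (x i) + e i w) * v (x i))"
      unfolding k_def using krr_normal_equation[of lam n x] assms(2,3) by auto
    have kf: "(\<lambda>z. k z - f z) \<in> H" using k assms diff_mem by blast
    have "lam * ip (\<lambda>z. k z - f z) g = reg_form ip n lam x h (\<lambda>z. k z - f z)"
      using h[OF kf] ip_commute[OF kf assms(5)] by simp
    also have "\<dots> = reg_form ip n lam x k h - reg_form ip n lam x f h"
      using reg_form_commute[OF assms(6) kf] reg_form_diff_left[OF k(1) assms(4,6)] by simp
    also have "\<dots> = 1 / real n * (\<Sum>i<n. h (x i) * e i w) - lam * ip f h"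
      unfolding k(2)[OF assms(6)] unfolding reg_form_def
      by (simp add: algebra_simps sum.distrib add_divide_distrib)
    finally have "ip (\<lambda>z. k z - f z) g = (1 / real n * (\<Sum>i<n. h (x i) * e i w) - lam * ip f h) / lam"
      using assms(2) by (metis less_irrefl nonzero_mult_div_cancel_left)
    then show ?thesis using assms(2) unfolding k_def by (simp add: diff_divide_distrib mult.commute)
  qed
  show ?thesis unfolding bias_def * using e by (simp add: prob_space)
qed

text \<open>
  By \<open>bias_eq_ip\<close> the bias is the functional \<open>f \<mapsto> - \<langle>f,h\<rangle>\<close>, whose norm is attained at \<open>h / \<parallel>h\<parallel>\<close>.
\<close>

lemma sup_bias_eq_hnorm:
  assumes "iid_errors M e \<sigma>" "0 < lam" "\<And>i. i < n \<Longrightarrow> x i \<in> \<Omega>" "g \<in> H"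
  shows "\<exists>h\<in>H. (\<forall>v\<in>H. reg_form ip n lam x h v = lam * ip g v) \<and>
    sup_bias M e H ip g n lam x = ereal (hnorm ip h)"
proof -
  obtain h where h: "h \<in> H" "\<And>v. v \<in> H \<Longrightarrow> reg_form ip n lam x h v = lam * ip g v"
    using ex_regularised_solution[of lam "1 / real n" n x "\<lambda>z. lam * g z"] assms scale_mem[OF assms(4)]
    by (auto simp: reg_form_def ip_scale_left)
  have b: "\<bar>bias M e H ip g n lam x f\<bar> = \<bar>ip f h\<bar>" if "f \<in> H" for f
    using bias_eq_ip[OF assms(1,2,3) that assms(4) h] by simp
  have "sup_bias M e H ip g n lam x = ereal (hnorm ip h)"
  proof (rule antisym)
    show "sup_bias M e H ip g n lam x \<le> ereal (hnorm ip h)"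
      unfolding sup_bias_def
    proof (rule SUP_least)
      fix f assume f: "f \<in> {f \<in> H. hnorm ip f \<le> 1}"
      then have "\<bar>ip f h\<bar> \<le> hnorm ip f * hnorm ip h" using cauchy_schwarz h by simp
      also have "\<dots> \<le> 1 * hnorm ip h" using f h hnorm_nonneg by (intro mult_right_mono) auto
      finally show "ereal \<bar>bias M e H ip g n lam x f\<bar> \<le> ereal (hnorm ip h)" using f b by simp
    qed
    (* If h = 0, division by zero makes c = 0, and the function c h still attains the supremum 0. *)
    define c where "c = 1 / hnorm ip h"
    have "\<bar>c\<bar> * hnorm ip h \<le> 1" using hnorm_nonneg[OF h(1)] by (simp add: c_def)
    then have f: "(\<lambda>z. c * h z) \<in> {f \<in> H. hnorm ip f \<le> 1}"
      using scale_mem[OF h(1)] hnorm_scale[OF h(1)] by simp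
    have "c * ip h h = hnorm ip h"
      by (simp add: c_def hnorm_square[OF h(1), symmetric] power2_eq_square)
    then have "\<bar>ip (\<lambda>z. c * h z) h\<bar> = hnorm ip h"
      using ip_scale_left[OF h(1) h(1)] hnorm_nonneg[OF h(1)] by simp
    then show "ereal (hnorm ip h) \<le> sup_bias M e H ip g n lam x"
      unfolding sup_bias_def using b f by (intro SUP_upper2[OF f]) auto
  qed
  then show ?thesis using h by blast
qed

end


section \<open>Bounds for the energy of the residual\<close>

text \<open>
  The \<open>L\<^sub>2\<close> norm fixes the type of the points, hence this specialisation.
\<close>

locale euclidean_rkhs = rkhs \<Omega> K H ip
  for \<Omega> :: "point set" and K :: "point \<Rightarrow> point \<Rightarrow> real" and H :: "(point \<Rightarrow> real) set"
    and ip :: "(point \<Rightarrow> real) \<Rightarrow> (point \<Rightarrow> real) \<Rightarrow> real"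

lemma L2_norm_nonneg: "0 \<le> L2_norm d \<Omega> v"
  unfolding L2_norm_def set_lebesgue_integral_def
  by (intro real_sqrt_ge_zero Bochner_Integration.integral_nonneg) simp

lemma emp_norm_nonneg: "0 \<le> emp_norm n x v"
  unfolding emp_norm_def by (simp add: sum_nonneg)

lemma (in rkhs) le_sqrt_reg_form:
  assumes "u \<in> H" "0 \<le> lam"
  shows "emp_norm n x u \<le> sqrt (reg_form ip n lam x u u)"
    and "sqrt lam * hnorm ip u \<le> sqrt (reg_form ip n lam x u u)"
  using assms by (auto simp: reg_form_eq power_mult_distrib intro!: real_le_rsqrt)

lemma growth_bound_witness:
  assumes "growth_bound d \<Omega> H ip g C0 R0 \<tau>" "R0 \<le> R" "0 < C0"
  obtains v where "v \<in> H" "0 < L2_norm d \<Omega> v" "hnorm ip v \<le> R * L2_norm d \<Omega> v"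
    "C0 * R powr (1 - \<tau>) * L2_norm d \<Omega> v < ip g v"
proof -
  obtain v where v: "v \<in> H" "hnorm ip v \<le> R * L2_norm d \<Omega> v"
    "C0 * R powr (1 - \<tau>) < ip g v / L2_norm d \<Omega> v"
    using assms(1,2) unfolding growth_bound_def by (auto simp: less_SUP_iff)
  have "0 \<le> C0 * R powr (1 - \<tau>)" using assms(3) by simp
  then have "L2_norm d \<Omega> v \<noteq> 0" using v(3) by auto
  then have "0 < L2_norm d \<Omega> v" using L2_norm_nonneg[of d \<Omega> v] by simp
  then show thesis using that v by (simp add: pos_less_divide_eq)
qed

text \<open>
  On functions with \<open>\<parallel>v\<parallel>\<^sub>\<H> \<le> R \<parallel>v\<parallel>\<^sub>L\<^sub>2\<close> the interpolation bound limits \<open>\<langle>g,v\<rangle> / \<parallel>v\<parallel>\<^sub>L\<^sub>2\<close> to \<open>C\<^sub>g R\<^sup>1\<^sup>-\<^sup>\<delta>\<close>, whereas the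
  growth bound makes it exceed \<open>C\<^sub>0 R\<^sup>1\<^sup>-\<^sup>\<tau>\<close>; for large \<open>R\<close> the exponents must be ordered.
\<close>

lemma (in euclidean_rkhs) interpolation_exponent_le_growth_exponent:
  assumes "growth_bound d \<Omega> H ip g C0 R0 \<tau>" "interpolation_bound d \<Omega> H ip g Cg \<delta>"
    and "0 < C0" "0 < R0" "\<delta> \<le> 1" "0 < Cg"
  shows "\<delta> \<le> \<tau>"
proof (rule ccontr)
  assume "\<not> \<delta> \<le> \<tau>"
  then have gap: "0 < \<delta> - \<tau>" by simp
  (* From this R on, R^(delta - tau) is at least Cg / C0. *)
  define R where "R = max R0 ((Cg / C0) powr (1 / (\<delta> - \<tau>)))"
  have R: "0 < R" "R0 \<le> R" using assms(4) by (auto simp: R_def)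
  obtain v where v: "v \<in> H" "0 < L2_norm d \<Omega> v" "hnorm ip v \<le> R * L2_norm d \<Omega> v"
    "C0 * R powr (1 - \<tau>) * L2_norm d \<Omega> v < ip g v"
    using growth_bound_witness[OF assms(1) R(2) assms(3)] by blast
  define l where "l = L2_norm d \<Omega> v"
  have "ip g v \<le> Cg * l powr \<delta> * hnorm ip v powr (1 - \<delta>)"
    using assms(2) v(1) by (force simp: interpolation_bound_def l_def)
  also have "\<dots> \<le> Cg * l powr \<delta> * (R * l) powr (1 - \<delta>)"
    using v assms hnorm_nonneg[OF v(1)] by (intro mult_left_mono powr_mono2) (auto simp: l_def)
  also have "\<dots> = Cg * R powr (1 - \<delta>) * l"
    using v(2) R(1) by (simp add: powr_mult l_def powr_add[symmetric])
  finally have "C0 * R powr (1 - \<tau>) * l < Cg * R powr (1 - \<delta>) * l"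
    using v(4) unfolding l_def by linarith
  then have "C0 * R powr (1 - \<tau>) < Cg * R powr (1 - \<delta>)"
    using v(2) unfolding l_def by simp
  moreover have "R powr (1 - \<tau>) = R powr (\<delta> - \<tau>) * R powr (1 - \<delta>)"
    by (simp add: powr_add[symmetric])
  ultimately have "C0 * R powr (\<delta> - \<tau>) < Cg" using R(1) by simp
  moreover have "Cg / C0 \<le> R powr (\<delta> - \<tau>)"
  proof -
    have "Cg / C0 = ((Cg / C0) powr (1 / (\<delta> - \<tau>))) powr (\<delta> - \<tau>)"
      using gap assms(3,6) by (simp add: powr_powr)
    also have "\<dots> \<le> R powr (\<delta> - \<tau>)"
      using gap by (intro powr_mono2) (auto simp: R_def)
    finally show ?thesis .
  qed
  ultimately show False using assms(3) by (simp add: pos_divide_le_eq mult.commute)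
qed

text \<open>
  The squared energy of \<open>h\<close> equals \<open>\<lambda> \<langle>g,h\<rangle>\<close>, and the norm comparison bounds the \<open>L\<^sub>2\<close> norm in the
  interpolation bound by the energy again; one factor \<open>S\<^sup>\<delta>\<close> then cancels.
\<close>

lemma (in euclidean_rkhs) residual_energy_upper:
  assumes h: "h \<in> H" "\<And>v. v \<in> H \<Longrightarrow> reg_form ip n lam x h v = lam * ip g v"
    and lam: "0 < lam" and pos: "0 < C1" "0 < Cg" "0 < \<delta>"
    and rho: "\<rho> \<le> sqrt lam"
    and cmp: "L2_norm d \<Omega> h \<le> max (C1 * emp_norm n x h) (\<rho> * hnorm ip h)"
    and interp: "interpolation_bound d \<Omega> H ip g Cg \<delta>"
  shows "sqrt (reg_form ip n lam x h h) powr (2 - \<delta>)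
    \<le> lam * (Cg * (1 + C1) powr \<delta>) * hnorm ip h powr (1 - \<delta>)"
proof -
  define N a S where "N = emp_norm n x h" and "a = hnorm ip h"
    and "S = sqrt (reg_form ip n lam x h h)"
  have NS: "N \<le> S" and aS: "sqrt lam * a \<le> S" and NA: "0 \<le> N" "0 \<le> a"
    unfolding N_def a_def S_def
    using le_sqrt_reg_form[OF h(1)] lam emp_norm_nonneg hnorm_nonneg[OF h(1)] by auto
  have S0: "0 \<le> S" using NS NA by linarith
  have "C1 * N \<le> C1 * S" using NS pos by simp
  then have "C1 * N \<le> (1 + C1) * S" using S0 unfolding distrib_right by linarith
  moreover have "\<rho> * a \<le> (1 + C1) * S"
    using mult_right_mono[OF rho NA(2)] aS mult_nonneg_nonneg[of C1 S] S0 pos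
    unfolding distrib_right by linarith
  ultimately have L: "L2_norm d \<Omega> h \<le> (1 + C1) * S" using cmp by (simp add: N_def a_def)
  have "S\<^sup>2 = lam * ip g h"
    using h S0 unfolding S_def by (metis real_sqrt_ge_0_iff real_sqrt_pow2)
  also have "\<dots> \<le> lam * (Cg * L2_norm d \<Omega> h powr \<delta> * a powr (1 - \<delta>))"
    using interp h(1) lam by (intro mult_left_mono) (force simp: interpolation_bound_def a_def)+
  also have "\<dots> \<le> lam * (Cg * ((1 + C1) * S) powr \<delta> * a powr (1 - \<delta>))"
    using L pos lam by (intro mult_left_mono mult_right_mono powr_mono2 L2_norm_nonneg) auto
  finally have main: "S\<^sup>2 \<le> S powr \<delta> * (lam * (Cg * (1 + C1) powr \<delta>) * a powr (1 - \<delta>))"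
    using S0 pos by (simp add: powr_mult ac_simps)
  have "S powr (2 - \<delta>) \<le> lam * (Cg * (1 + C1) powr \<delta>) * a powr (1 - \<delta>)"
  proof (cases "S = 0")
    case True
    then show ?thesis using lam pos by simp
  next
    case False
    then have "0 < S" using S0 by simp
    moreover from this have "S\<^sup>2 = S powr \<delta> * S powr (2 - \<delta>)"
      by (simp add: powr_add[symmetric])
    ultimately show ?thesis using main by simp
  qed
  then show ?thesis by (simp add: S_def a_def)
qed

text \<open>
  At the scale \<open>R = \<lambda>\<^sup>-\<^sup>1\<^sup>/\<^sup>2\<close> both parts of the energy of the witness \<open>v\<close> have at most the order of
  \<open>\<parallel>v\<parallel>\<^sub>L\<^sub>2\<close>. A larger \<open>R\<close> would let \<open>\<lambda>\<^sup>1\<^sup>/\<^sup>2 \<parallel>v\<parallel>\<^sub>\<H>\<close> dominate, and a smaller one would waste growth of \<open>\<langle>g,v\<rangle>\<close>.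
\<close>

lemma (in euclidean_rkhs) residual_energy_lower:
  assumes h: "h \<in> H" "\<And>v. v \<in> H \<Longrightarrow> reg_form ip n lam x h v = lam * ip g v"
    and lam: "0 < lam" "lam \<le> R0 powr (-2)" and pos: "0 < C0" "0 < C1" "0 < R0"
    and rho: "\<rho> \<le> sqrt lam"
    and cmp: "\<And>v. v \<in> H \<Longrightarrow> emp_norm n x v \<le> max (C1 * L2_norm d \<Omega> v) (\<rho> * hnorm ip v)"
    and growth: "growth_bound d \<Omega> H ip g C0 R0 \<tau>"
  shows "C0 / (2 + C1) * lam powr ((1 + \<tau>) / 2) \<le> sqrt (reg_form ip n lam x h h)"
proof -
  define N a S where "N = emp_norm n x h" and "a = hnorm ip h"
    and "S = sqrt (reg_form ip n lam x h h)"
  have NS: "N \<le> S" and aS: "sqrt lam * a \<le> S" and NA: "0 \<le> N" "0 \<le> a"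
    unfolding N_def a_def S_def
    using le_sqrt_reg_form[OF h(1)] lam emp_norm_nonneg hnorm_nonneg[OF h(1)] by auto
  define R where "R = lam powr (- (1 / 2))"
  have "(R0 powr (-2)) powr (- (1 / 2)) \<le> R"
    unfolding R_def using lam pos by (intro powr_mono2') auto
  then have R0R: "R0 \<le> R" using pos by (simp add: powr_powr)
  have sqrtR: "sqrt lam * R = 1"
    using lam by (simp add: R_def powr_half_sqrt[symmetric] powr_add[symmetric])
  obtain v where v: "v \<in> H" "0 < L2_norm d \<Omega> v" "hnorm ip v \<le> R * L2_norm d \<Omega> v"
    "C0 * R powr (1 - \<tau>) * L2_norm d \<Omega> v < ip g v"
    using growth_bound_witness[OF growth R0R pos(1)] by blast
  define l where "l = L2_norm d \<Omega> v"
  have b: "sqrt lam * hnorm ip v \<le> l"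
    using mult_left_mono[OF v(3), of "sqrt lam"] lam sqrtR by (simp add: l_def mult.assoc[symmetric])
  have "\<rho> * hnorm ip v \<le> l"
    using mult_right_mono[OF rho hnorm_nonneg[OF v(1)]] b by linarith
  then have Nv: "emp_norm n x v \<le> (1 + C1) * l"
    using cmp[OF v(1)] v(2) pos mult_pos_pos[of C1 l] unfolding l_def distrib_right by linarith
  have "lam * (C0 * R powr (1 - \<tau>) * l) \<le> lam * ip g v"
    using v(4) lam by (simp add: l_def)
  also have "\<dots> \<le> N * emp_norm n x v + lam * (a * hnorm ip v)"
    using reg_form_le[OF h(1) v(1), of lam n x] lam h(2)[OF v(1)] by (simp add: N_def a_def)
  also have "lam * (a * hnorm ip v) = (sqrt lam * a) * (sqrt lam * hnorm ip v)"
    using lam by simp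
  also have "N * emp_norm n x v + (sqrt lam * a) * (sqrt lam * hnorm ip v) \<le> S * ((1 + C1) * l) + S * l"
    using NS aS Nv b NA lam hnorm_nonneg[OF v(1)]
    by (intro add_mono mult_mono emp_norm_nonneg mult_nonneg_nonneg) auto
  also have "\<dots> = (2 + C1) * S * l" by (simp add: algebra_simps)
  finally have "lam * (C0 * R powr (1 - \<tau>)) * l \<le> (2 + C1) * S * l" by (simp only: mult.assoc)
  then have "lam * (C0 * R powr (1 - \<tau>)) \<le> (2 + C1) * S" using v(2) by (simp add: l_def)
  moreover have "lam * R powr (1 - \<tau>) = lam powr ((1 + \<tau>) / 2)"
  proof -
    have "lam * R powr (1 - \<tau>) = lam powr (1 + - (1 / 2) * (1 - \<tau>))"
      using lam by (simp only: R_def powr_powr powr_add powr_one less_imp_le)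
    also have "1 + - (1 / 2) * (1 - \<tau>) = (1 + \<tau>) / 2" by (simp add: field_simps)
    finally show ?thesis .
  qed
  ultimately have "C0 * lam powr ((1 + \<tau>) / 2) \<le> (2 + C1) * S" by (simp add: mult.left_commute)
  then show ?thesis using pos unfolding S_def by (simp add: pos_divide_le_eq mult.commute)
qed

text \<open>
  Inserting \<open>\<lambda>\<^sup>1\<^sup>/\<^sup>2 a \<le> S\<close> on the left leaves the power \<open>a\<^sup>2\<^sup>-\<^sup>\<delta>\<close> there against \<open>a\<^sup>1\<^sup>-\<^sup>\<delta>\<close> on the right.
\<close>

lemma powr_bootstrap_upper:
  fixes lam :: real
  assumes "0 < lam" "0 < Q" "0 \<le> a" "0 < \<delta>" "\<delta> < 1" "sqrt lam * a \<le> S"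
    "S powr (2 - \<delta>) \<le> lam * Q * a powr (1 - \<delta>)"
  shows "a \<le> Q * lam powr (\<delta> / 2)"
proof (cases "a = 0")
  case False
  then have a: "0 < a" using assms by simp
  have "(lam powr (1 / 2) * a) powr (2 - \<delta>) \<le> S powr (2 - \<delta>)"
    using assms by (intro powr_mono2) (auto simp: powr_half_sqrt)
  then have "lam powr ((1 / 2) * (2 - \<delta>)) * a powr (2 - \<delta>) \<le> lam * Q * a powr (1 - \<delta>)"
    using assms by (simp add: powr_mult powr_powr)
  moreover have "a powr (2 - \<delta>) = a * a powr (1 - \<delta>)"
    using a powr_add[of a 1 "1 - \<delta>"] by simp
  ultimately have "lam powr ((1 / 2) * (2 - \<delta>)) * a \<le> lam * Q"
    using a by simp
  moreover have "lam = lam powr ((1 / 2) * (2 - \<delta>)) * lam powr (\<delta> / 2)"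
    using assms(1) by (simp add: powr_add[symmetric] field_simps)
  ultimately have "lam powr ((1 / 2) * (2 - \<delta>)) * a
      \<le> lam powr ((1 / 2) * (2 - \<delta>)) * (Q * lam powr (\<delta> / 2))"
    by (metis mult.assoc mult.commute)
  then show ?thesis using assms(1) by (metis mult_le_cancel_left_pos powr_gt_zero less_irrefl)
qed (use assms in auto)

lemma powr_bootstrap_lower:
  fixes lam :: real
  assumes "0 < lam" "0 < Q" "0 \<le> a" "0 < \<delta>" "\<delta> < 1" "0 < \<kappa>" "\<kappa> * lam powr ((1 + \<tau>) / 2) \<le> S"
    "S powr (2 - \<delta>) \<le> lam * Q * a powr (1 - \<delta>)"
  shows "(\<kappa> powr (2 - \<delta>) / Q) powr (1 / (1 - \<delta>))
      * lam powr ((2 * \<tau> - \<delta> - \<delta> * \<tau>) / (2 * (1 - \<delta>))) \<le> a"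
proof -
  define q where "q = (2 * \<tau> - \<delta> - \<delta> * \<tau>) / 2"
  have "(\<kappa> * lam powr ((1 + \<tau>) / 2)) powr (2 - \<delta>) \<le> S powr (2 - \<delta>)"
    using assms by (intro powr_mono2) auto
  then have "\<kappa> powr (2 - \<delta>) * lam powr ((1 + \<tau>) / 2 * (2 - \<delta>)) \<le> lam * (Q * a powr (1 - \<delta>))"
    using assms by (simp add: powr_mult powr_powr)
  moreover have "lam powr ((1 + \<tau>) / 2 * (2 - \<delta>)) = lam * lam powr q"
  proof -
    have e: "(1 + \<tau>) / 2 * (2 - \<delta>) = 1 + q" by (simp add: q_def field_simps)
    show ?thesis unfolding e using assms(1) by (simp add: powr_add)
  qed
  ultimately have "lam * (\<kappa> powr (2 - \<delta>) * lam powr q) \<le> lam * (Q * a powr (1 - \<delta>))"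
    by (simp only: mult.left_commute)
  then have "\<kappa> powr (2 - \<delta>) / Q * lam powr q \<le> a powr (1 - \<delta>)"
    using assms(1,2) by (simp add: field_simps)
  then have "(\<kappa> powr (2 - \<delta>) / Q * lam powr q) powr (1 / (1 - \<delta>)) \<le> (a powr (1 - \<delta>)) powr (1 / (1 - \<delta>))"
    using assms by (intro powr_mono2) auto
  also have "\<dots> = a" using assms by (simp add: powr_powr)
  also have "(\<kappa> powr (2 - \<delta>) / Q * lam powr q) powr (1 / (1 - \<delta>))
      = (\<kappa> powr (2 - \<delta>) / Q) powr (1 / (1 - \<delta>)) * lam powr (q * (1 / (1 - \<delta>)))"
    using assms by (simp only: powr_mult powr_powr powr_ge_zero divide_nonneg_pos)
  also have "q * (1 / (1 - \<delta>)) = (2 * \<tau> - \<delta> - \<delta> * \<tau>) / (2 * (1 - \<delta>))"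
    by (simp add: q_def)
  finally show ?thesis .
qed

text \<open>
  Over the common denominator \<open>2\<tau>(1 - \<delta>)\<close> the numerators differ by \<open>(2 - \<delta>)(\<tau> - \<delta>)(1 - \<tau>)\<close>.
\<close>

lemma bootstrap_exponent_le:
  fixes \<delta> \<tau> :: real
  assumes "0 < \<delta>" "\<delta> < 1" "\<delta> \<le> \<tau>" "\<tau> \<le> 1"
  shows "(2 * \<tau> - \<delta> - \<delta> * \<tau>) / (2 * (1 - \<delta>))
      \<le> (2 * \<tau> - 2 * \<delta> + \<delta>\<^sup>2 - \<delta>\<^sup>2 * \<tau>) / (2 * \<tau> * (1 - \<delta>))"
proof -
  have t: "0 < \<tau>" using assms by simp
  have "0 \<le> (2 - \<delta>) * (\<tau> - \<delta>) * (1 - \<tau>)" using assms by simp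
  then have "\<tau> * (2 * \<tau> - \<delta> - \<delta> * \<tau>) \<le> 2 * \<tau> - 2 * \<delta> + \<delta>\<^sup>2 - \<delta>\<^sup>2 * \<tau>"
    by (simp add: algebra_simps power2_eq_square)
  then have "\<tau> * (2 * \<tau> - \<delta> - \<delta> * \<tau>) / (\<tau> * (2 * (1 - \<delta>)))
      \<le> (2 * \<tau> - 2 * \<delta> + \<delta>\<^sup>2 - \<delta>\<^sup>2 * \<tau>) / (\<tau> * (2 * (1 - \<delta>)))"
    using assms t by (intro divide_right_mono) auto
  then show ?thesis using t by (simp add: mult.left_commute mult.assoc)
qed


section \<open>The rate for interpolation exponents below one\<close>

text \<open>
  The two energy estimates, solved for \<open>\<parallel>h\<parallel>\<close>, for a fixed design on which the norm comparison holds with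
  remainder \<open>\<rho> \<parallel>v\<parallel> \<le> \<lambda>\<^sup>1\<^sup>/\<^sup>2 \<parallel>v\<parallel>\<close>.
\<close>

lemma (in euclidean_rkhs) sup_bias_bounds:
  assumes "iid_errors M e \<sigma>" "\<And>i. i < n \<Longrightarrow> x i \<in> \<Omega>" "g \<in> H"
    and interp: "interpolation_bound d \<Omega> H ip g Cg \<delta>"
    and growth: "growth_bound d \<Omega> H ip g C0 R0 \<tau>"
    and pos: "0 < C0" "0 < C1" "0 < Cg" "0 < R0" "0 < \<delta>" "\<delta> < 1" "\<tau> \<le> 1"
    and lam: "0 < lam" "lam \<le> 1" "lam \<le> R0 powr (-2)"
    and rho: "\<rho> \<le> sqrt lam"
    and cmp: "\<And>v. v \<in> H \<Longrightarrow> L2_norm d \<Omega> v \<le> max (C1 * emp_norm n x v) (\<rho> * hnorm ip v)"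
      "\<And>v. v \<in> H \<Longrightarrow> emp_norm n x v \<le> max (C1 * L2_norm d \<Omega> v) (\<rho> * hnorm ip v)"
  shows "ereal (((C0 / (2 + C1)) powr (2 - \<delta>) / (Cg * (1 + C1) powr \<delta>)) powr (1 / (1 - \<delta>))
        * lam powr ((2*\<tau> - 2*\<delta> + \<delta>\<^sup>2 - \<delta>\<^sup>2 * \<tau>) / (2 * \<tau> * (1 - \<delta>))))
      \<le> sup_bias M e H ip g n lam x"
    and "sup_bias M e H ip g n lam x \<le> ereal (Cg * (1 + C1) powr \<delta> * lam powr (\<delta> / 2))"
proof -
  obtain h where h: "h \<in> H" "\<And>v. v \<in> H \<Longrightarrow> reg_form ip n lam x h v = lam * ip g v"
    and sup: "sup_bias M e H ip g n lam x = ereal (hnorm ip h)"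
    using sup_bias_eq_hnorm[of M e \<sigma> lam n x g] assms(1-3) lam(1) by blast
  define a S where "a = hnorm ip h" and "S = sqrt (reg_form ip n lam x h h)"
  define Q \<kappa> where "Q = Cg * (1 + C1) powr \<delta>" and "\<kappa> = C0 / (2 + C1)"
  have Q: "0 < Q" and \<kappa>: "0 < \<kappa>" using pos by (simp_all add: Q_def \<kappa>_def)
  have a: "0 \<le> a" using h(1) by (simp add: a_def hnorm_nonneg)
  have upper: "S powr (2 - \<delta>) \<le> lam * Q * a powr (1 - \<delta>)"
    unfolding S_def Q_def a_def
    by (rule residual_energy_upper[OF h lam(1) pos(2,3,5) rho cmp(1)[OF h(1)] interp])
  have lower: "\<kappa> * lam powr ((1 + \<tau>) / 2) \<le> S"
    unfolding S_def \<kappa>_def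
    by (rule residual_energy_lower[OF h lam(1,3) pos(1,2,4) rho cmp(2) growth])
  have "sqrt lam * a \<le> S"
    unfolding a_def S_def using le_sqrt_reg_form(2)[OF h(1)] lam(1) by simp
  then have "a \<le> Q * lam powr (\<delta> / 2)"
    using powr_bootstrap_upper[OF lam(1) Q a pos(5,6) _ upper] by blast
  then show "sup_bias M e H ip g n lam x \<le> ereal (Cg * (1 + C1) powr \<delta> * lam powr (\<delta> / 2))"
    by (simp add: sup a_def Q_def)
  have "\<delta> \<le> \<tau>"
    using interpolation_exponent_le_growth_exponent[OF growth interp] pos by simp
  then have "lam powr ((2*\<tau> - 2*\<delta> + \<delta>\<^sup>2 - \<delta>\<^sup>2 * \<tau>) / (2 * \<tau> * (1 - \<delta>)))
      \<le> lam powr ((2 * \<tau> - \<delta> - \<delta> * \<tau>) / (2 * (1 - \<delta>)))"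
    using lam pos by (intro powr_mono' bootstrap_exponent_le) auto
  then have "(\<kappa> powr (2 - \<delta>) / Q) powr (1 / (1 - \<delta>))
        * lam powr ((2*\<tau> - 2*\<delta> + \<delta>\<^sup>2 - \<delta>\<^sup>2 * \<tau>) / (2 * \<tau> * (1 - \<delta>)))
      \<le> (\<kappa> powr (2 - \<delta>) / Q) powr (1 / (1 - \<delta>)) * lam powr ((2 * \<tau> - \<delta> - \<delta> * \<tau>) / (2 * (1 - \<delta>)))"
    by (intro mult_left_mono) auto
  also have "\<dots> \<le> a"
    by (rule powr_bootstrap_lower[OF lam(1) Q a pos(5,6) \<kappa> lower upper])
  finally show "ereal (((C0 / (2 + C1)) powr (2 - \<delta>) / (Cg * (1 + C1) powr \<delta>)) powr (1 / (1 - \<delta>))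
        * lam powr ((2*\<tau> - 2*\<delta> + \<delta>\<^sup>2 - \<delta>\<^sup>2 * \<tau>) / (2 * \<tau> * (1 - \<delta>))))
      \<le> sup_bias M e H ip g n lam x"
    by (simp add: sup a_def Q_def \<kappa>_def)
qed


section \<open>Sobolev embedding\<close>

text \<open>
  Since \<open>(1 + \<bar>x\<bar>)\<^sup>2 \<le> 2 (1 + x\<^sup>2)\<close>, the power \<open>(1 + \<bar>x\<bar>)\<^sup>-\<^sup>2\<^sup>s\<close> dominates, and it has an explicit primitive on
  each half-line.
\<close>

lemma integrable_one_plus_square_powr:
  assumes "1 / 2 < s"
  shows "integrable lborel (\<lambda>x::real. (1 + x\<^sup>2) powr (- s))"
proof -
  define p where "p = (\<lambda>x::real. indicator {0..} x *\<^sub>R (1 + x) powr (- (2 * s)))"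
  have "(\<integral>\<^sup>+x. ennreal ((1 + x) powr (- (2 * s))) * indicator {0..} x \<partial>lborel)
      = ennreal (0 - (1 + 0) powr (1 - 2 * s) / (1 - 2 * s))"
  proof (rule nn_integral_FTC_atLeast)
    show "((\<lambda>x. (1 + x) powr (1 - 2 * s) / (1 - 2 * s)) \<longlongrightarrow> 0) at_top"
    proof (rule tendsto_eq_intros)
      show "((\<lambda>x. (1 + x) powr (1 - 2 * s)) \<longlongrightarrow> 0) at_top"
        by (rule tendsto_neg_powr)
          (use assms in \<open>auto intro!: filterlim_tendsto_add_at_top filterlim_ident tendsto_const\<close>)
    qed (use assms in auto)
    show "((\<lambda>x. (1 + x) powr (1 - 2 * s) / (1 - 2 * s)) has_real_derivative (1 + x) powr (- (2 * s))) (at x)"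
      if "0 \<le> x" for x
      using assms that by (auto intro!: derivative_eq_intros)
  qed auto
  then have "(\<integral>\<^sup>+x. ennreal (p x) \<partial>lborel) < \<infinity>"
    by (simp add: p_def ennreal_indicator ennreal_mult' mult.commute)
  then have p: "integrable lborel p"
    by (intro integrableI_nonneg) (auto simp: p_def)
  then have "integrable lborel (\<lambda>x. p (0 + (-1) * x))"
    by (rule lborel_integrable_real_affine) simp
  then have "integrable lborel (\<lambda>x. 2 powr s * (p x + p (- x)))"
    using p by simp
  then show ?thesis
  proof (rule Bochner_Integration.integrable_bound)
    show "AE x in lborel. norm ((1 + x\<^sup>2) powr (- s)) \<le> norm (2 powr s * (p x + p (- x)))"
    proof (rule AE_I2)
      fix x :: real
      have "(1 + \<bar>x\<bar>)\<^sup>2 \<le> 2 * (1 + x\<^sup>2)"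
        using zero_le_power2[of "1 - \<bar>x\<bar>"] by (simp add: power2_eq_square algebra_simps)
      then have "(1 + x\<^sup>2) powr (- s) \<le> ((1 + \<bar>x\<bar>)\<^sup>2 / 2) powr (- s)"
        using assms by (intro powr_mono2') auto
      also have "\<dots> = 2 powr s * (1 + \<bar>x\<bar>) powr (- (2 * s))"
      proof -
        have "(1 + \<bar>x\<bar>)\<^sup>2 = (1 + \<bar>x\<bar>) powr 2" by simp
        then show ?thesis unfolding \<open>(1 + \<bar>x\<bar>)\<^sup>2 = _\<close>
          by (simp add: powr_divide powr_minus powr_powr field_simps del: powr_numeral)
      qed
      also have "\<dots> \<le> 2 powr s * (p x + p (- x))"
        by (intro mult_left_mono) (auto simp: p_def indicator_def)
      finally show "norm ((1 + x\<^sup>2) powr (- s)) \<le> norm (2 powr s * (p x + p (- x)))"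
        by simp
    qed
  qed simp
qed

lemma dot_measurable: "(\<lambda>\<xi>. dot d \<xi> \<xi>) \<in> borel_measurable (leb d)"
  unfolding dot_def leb_def by measurable

text \<open>
  Every factor \<open>1 + \<xi>\<^sub>i\<^sup>2\<close> is at most \<open>1 + \<bar>\<xi>\<bar>\<^sup>2\<close>, so the weight is dominated by the product of the
  one-dimensional weights \<open>(1 + \<xi>\<^sub>i\<^sup>2)\<^sup>-\<^sup>m\<^sup>/\<^sup>d\<close>, and \<open>m > d/2\<close> says that their exponent exceeds \<open>1/2\<close>.
\<close>

lemma integrable_inverse_sobolev_weight:
  assumes "1 \<le> d" "real d / 2 < m"
  shows "integrable (leb d) (\<lambda>\<xi>. (1 + dot d \<xi> \<xi>) powr (- m))"
proof -
  interpret product_sigma_finite "\<lambda>_::nat. lborel :: real measure" by standard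
  have "1 / 2 < m / real d" using assms by (simp add: field_simps)
  then have "integrable (leb d) (\<lambda>\<xi>. \<Prod>i<d. (1 + (\<xi> i)\<^sup>2) powr (- (m / real d)))"
    unfolding leb_def by (intro product_integrable_prod integrable_one_plus_square_powr) auto
  then show ?thesis
  proof (rule Bochner_Integration.integrable_bound)
    show "(\<lambda>\<xi>. (1 + dot d \<xi> \<xi>) powr (- m)) \<in> borel_measurable (leb d)"
      using dot_measurable by measurable
    show "AE \<xi> in leb d. norm ((1 + dot d \<xi> \<xi>) powr (- m))
        \<le> norm (\<Prod>i<d. (1 + (\<xi> i)\<^sup>2) powr (- (m / real d)))"
    proof (rule AE_I2)
      fix \<xi> :: point
      have nn: "0 \<le> dot d \<xi> \<xi>" by (simp add: dot_def sum_nonneg)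
      have "(1 + dot d \<xi> \<xi>) powr (- m) = (\<Prod>i<d. (1 + dot d \<xi> \<xi>) powr (- (m / real d)))"
        using assms nn by (simp add: powr_realpow[symmetric] powr_powr powr_power)
      also have "\<dots> \<le> (\<Prod>i<d. (1 + (\<xi> i)\<^sup>2) powr (- (m / real d)))"
      proof (rule prod_mono, safe)
        fix i assume "i < d"
        then have "(\<xi> i)\<^sup>2 \<le> dot d \<xi> \<xi>"
          unfolding dot_def power2_eq_square by (intro member_le_sum) auto
        then show "(1 + dot d \<xi> \<xi>) powr (- (m / real d)) \<le> (1 + (\<xi> i)\<^sup>2) powr (- (m / real d))"
          using assms by (intro powr_mono2') (auto simp: add_pos_nonneg)
      qed auto
      finally show "norm ((1 + dot d \<xi> \<xi>) powr (- m))
          \<le> norm (\<Prod>i<d. (1 + (\<xi> i)\<^sup>2) powr (- (m / real d)))"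
        by (simp add: prod_nonneg)
    qed
  qed
qed

text \<open>
  The value \<open>\<bar>f(x)\<bar>\<close> is at most a multiple of \<open>\<parallel>\<phi>\<parallel>\<^sub>L\<^sub>1\<close>, which is controlled by the weighted \<open>L\<^sub>2\<close> norm of \<open>\<phi>\<close>
  and the integral of the inverse weight. If \<open>\<phi>\<close> were not integrable, both integrals would have the
  default value \<open>0\<close>, so the first bound can be used before integrability is known.
\<close>

lemma sobolev_embedding:
  assumes "1 \<le> d" "real d / 2 < m" "f \<in> sobolev_space d m \<Omega>" "x \<in> \<Omega>"
  shows "\<bar>f x\<bar> \<le> (2 * pi) powr (- (real d / 2))
           * (((LINT \<xi>|leb d. (1 + dot d \<xi> \<xi>) powr (- m)) + 1) / 2) * sobolev_norm d m \<Omega> f"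
proof -
  define W where "W = (\<lambda>\<xi>. 1 + dot d \<xi> \<xi>)"
  define c where "c = (2 * pi) powr (- (real d / 2))"
  define I where "I = (LINT \<xi>|leb d. W \<xi> powr (- m))"
  define E where "E = (\<lambda>\<phi>::point \<Rightarrow> complex. LINT \<xi>|leb d. W \<xi> powr m * (cmod (\<phi> \<xi>))\<^sup>2)"
  have W: "0 < W \<xi>" for \<xi> by (simp add: W_def dot_def sum_nonneg add_pos_nonneg)
  have int_W: "integrable (leb d) (\<lambda>\<xi>. W \<xi> powr (- m))"
    using integrable_inverse_sobolev_weight[OF assms(1,2)] by (simp add: W_def)
  have I: "0 \<le> I" unfolding I_def by (rule Bochner_Integration.integral_nonneg) simp
  have c: "0 < c" by (simp add: c_def)
  have bound: "\<bar>f x\<bar> \<le> c * ((I + 1) / 2) * t" if t: "sobolev_norm d m \<Omega> f < t" for t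
  proof -
    have "{sqrt (E \<phi>) |\<phi>. sobolev_ext d m \<Omega> f \<phi>} \<noteq> {}"
      using assms(3) by (auto simp: sobolev_space_def)
    then obtain \<phi> where \<phi>: "sobolev_ext d m \<Omega> f \<phi>" "sqrt (E \<phi>) < t"
      using cInf_lessD[of "{sqrt (E \<phi>) |\<phi>. sobolev_ext d m \<Omega> f \<phi>}" t] t
      by (auto simp: sobolev_norm_def E_def W_def)
    have E: "0 \<le> E \<phi>" unfolding E_def by (rule Bochner_Integration.integral_nonneg) simp
    then have tpos: "0 < t" using \<phi>(2) real_sqrt_ge_zero[OF E] by linarith
    have Et: "E \<phi> \<le> t\<^sup>2" using \<phi>(2) E by (metis less_imp_le real_sqrt_le_iff real_sqrt_unique tpos real_sqrt_abs abs_of_pos)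
    have int_E: "integrable (leb d) (\<lambda>\<xi>. W \<xi> powr m * (cmod (\<phi> \<xi>))\<^sup>2)"
      using \<phi>(1) by (simp add: sobolev_ext_def W_def)
    (* Cauchy-Schwarz in the form of the weighted inequality of the means. The weight t is any bound
       above the infimum, so it is positive even if the Sobolev norm vanishes. *)
    have amgm: "cmod (\<phi> \<xi>) \<le> t / 2 * W \<xi> powr (- m) + 1 / (2 * t) * (W \<xi> powr m * (cmod (\<phi> \<xi>))\<^sup>2)" for \<xi>
    proof -
      define q where "q = W \<xi> powr m"
      have q: "0 < q" using W[of \<xi>] by (simp add: q_def)
      have "0 \<le> (t - q * cmod (\<phi> \<xi>))\<^sup>2 / (2 * t * q)" using tpos q by simp
      also have "\<dots> = t / 2 * (1 / q) + 1 / (2 * t) * (q * (cmod (\<phi> \<xi>))\<^sup>2) - cmod (\<phi> \<xi>)"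
        using tpos q by (simp add: field_simps power2_eq_square)
      finally show ?thesis by (simp add: q_def powr_minus_divide)
    qed
    have "(LINT \<xi>|leb d. cmod (\<phi> \<xi>))
        \<le> (LINT \<xi>|leb d. t / 2 * W \<xi> powr (- m) + 1 / (2 * t) * (W \<xi> powr m * (cmod (\<phi> \<xi>))\<^sup>2))"
      using int_W int_E amgm tpos by (intro integral_mono') auto
    also have "\<dots> = t / 2 * I + 1 / (2 * t) * E \<phi>"
      using int_W int_E by (simp add: I_def E_def)
    also have "\<dots> \<le> t / 2 * I + 1 / (2 * t) * t\<^sup>2"
      using Et tpos by (intro add_left_mono mult_left_mono) auto
    also have "\<dots> = (I + 1) / 2 * t" using tpos by (simp add: field_simps power2_eq_square)
    finally have int_le: "(LINT \<xi>|leb d. cmod (\<phi> \<xi>)) \<le> (I + 1) / 2 * t" .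
    have "complex_of_real (f x) = complex_of_real c * (LINT \<xi>|leb d. \<phi> \<xi> * cis (dot d x \<xi>))"
      using \<phi>(1) assms(4) by (simp add: sobolev_ext_def c_def)
    then have "\<bar>f x\<bar> = c * cmod (LINT \<xi>|leb d. \<phi> \<xi> * cis (dot d x \<xi>))"
      using c by (metis norm_mult norm_of_real abs_of_pos)
    also have "\<dots> \<le> c * (LINT \<xi>|leb d. cmod (\<phi> \<xi> * cis (dot d x \<xi>)))"
      using c by (intro mult_left_mono integral_norm_bound) auto
    also have "\<dots> \<le> c * ((I + 1) / 2 * t)"
      using c int_le by (simp add: norm_mult)
    finally show ?thesis by (simp only: mult.assoc)
  qed
  have "\<bar>f x\<bar> \<le> c * ((I + 1) / 2) * sobolev_norm d m \<Omega> f"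
  proof -
    have k: "0 < c * ((I + 1) / 2)" using c I by simp
    have "\<bar>f x\<bar> / (c * ((I + 1) / 2)) \<le> sobolev_norm d m \<Omega> f"
      by (rule dense_ge) (use bound k in \<open>simp add: pos_divide_le_eq mult.commute\<close>)
    then show ?thesis using k by (simp only: pos_divide_le_eq mult.commute)
  qed
  then show ?thesis by (simp only: c_def I_def W_def)
qed


section \<open>Lower bound from bounded evaluations\<close>

text \<open>
  Bounded evaluations give \<open>\<parallel>v\<parallel>\<^sub>n \<le> B \<parallel>v\<parallel>\<close>. The identity \<open>\<lambda> \<parallel>g\<parallel>\<^sup>2 = \<langle>h,g\<rangle>\<^sub>n + \<lambda> \<langle>h,g\<rangle>\<close> then shows that the
  regularisation cannot shrink \<open>g\<close> by more than the factor \<open>\<lambda> / (B\<^sup>2 + \<lambda>)\<close>.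
\<close>

lemma (in rkhs) sup_bias_ge_of_bounded_evaluation:
  assumes "iid_errors M e \<sigma>" "0 < lam" "\<And>i. i < n \<Longrightarrow> x i \<in> \<Omega>" "g \<in> H" "1 \<le> n"
    and B: "\<And>v z. v \<in> H \<Longrightarrow> z \<in> \<Omega> \<Longrightarrow> \<bar>v z\<bar> \<le> B * hnorm ip v" "0 \<le> B"
  shows "ereal (lam * hnorm ip g / (B\<^sup>2 + lam)) \<le> sup_bias M e H ip g n lam x"
proof -
  have "\<exists>h\<in>H. (\<forall>v\<in>H. reg_form ip n lam x h v = lam * ip g v) \<and>
      sup_bias M e H ip g n lam x = ereal (hnorm ip h)"
    by (rule sup_bias_eq_hnorm[OF assms(1,2) _ assms(4)]) (rule assms(3))
  then obtain h where h: "h \<in> H" "\<And>v. v \<in> H \<Longrightarrow> reg_form ip n lam x h v = lam * ip g v"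
    "sup_bias M e H ip g n lam x = ereal (hnorm ip h)"
    by blast
  have emp: "emp_norm n x v \<le> B * hnorm ip v" if v: "v \<in> H" for v
  proof -
    have "(\<Sum>i<n. (v (x i))\<^sup>2) \<le> (\<Sum>i<n. (B * hnorm ip v)\<^sup>2)"
      using B(1)[OF v] B(2) hnorm_nonneg[OF v] assms(3)
      by (intro sum_mono) (metis abs_le_square_iff abs_of_nonneg lessThan_iff mult_nonneg_nonneg)
    then have "1 / real n * (\<Sum>i<n. (v (x i))\<^sup>2) \<le> (B * hnorm ip v)\<^sup>2"
      using assms(5) by (simp add: field_simps)
    then show ?thesis unfolding emp_norm_def
      using B(2) hnorm_nonneg[OF v] by (intro real_le_lsqrt) auto
  qed
  have "lam * (hnorm ip g)\<^sup>2 = reg_form ip n lam x h g"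
    using h(2) assms(4) by (simp add: hnorm_square)
  also have "\<dots> \<le> emp_norm n x h * emp_norm n x g + lam * (hnorm ip h * hnorm ip g)"
    using reg_form_le[OF h(1) assms(4), of lam n x] assms(2) by simp
  also have "\<dots> \<le> (B * hnorm ip h) * (B * hnorm ip g) + lam * (hnorm ip h * hnorm ip g)"
    using emp h(1) assms(4) B(2) hnorm_nonneg
    by (intro add_right_mono mult_mono emp_norm_nonneg mult_nonneg_nonneg) auto
  also have "\<dots> = (B\<^sup>2 + lam) * hnorm ip h * hnorm ip g"
    by (simp add: power2_eq_square algebra_simps)
  finally have *: "lam * hnorm ip g * hnorm ip g \<le> (B\<^sup>2 + lam) * hnorm ip h * hnorm ip g"
    by (simp add: power2_eq_square mult.assoc)
  have pos: "0 < B\<^sup>2 + lam" using assms(2) by (simp add: add_nonneg_pos)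
  have "lam * hnorm ip g \<le> (B\<^sup>2 + lam) * hnorm ip h"
  proof (cases "hnorm ip g = 0")
    case True
    then show ?thesis using pos hnorm_nonneg[OF h(1)] by simp
  next
    case False
    then have "0 < hnorm ip g" using hnorm_nonneg[OF assms(4)] by simp
    then show ?thesis using * by simp
  qed
  then show ?thesis using pos h(3) by (simp add: pos_divide_le_eq mult.commute)
qed

text \<open>
  Cauchy--Schwarz applied to a single witness of the growth bound, at \<open>R = R\<^sub>0\<close>.
\<close>

lemma (in euclidean_rkhs) hnorm_ge_of_growth_bound:
  assumes "growth_bound d \<Omega> H ip g C0 R0 \<tau>" "0 < C0" "0 < R0" "g \<in> H"
  shows "C0 * R0 powr (- \<tau>) \<le> hnorm ip g"
proof -
  obtain v where v: "v \<in> H" "0 < L2_norm d \<Omega> v" "hnorm ip v \<le> R0 * L2_norm d \<Omega> v"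
    "C0 * R0 powr (1 - \<tau>) * L2_norm d \<Omega> v < ip g v"
    using growth_bound_witness[OF assms(1) order_refl assms(2)] by blast
  have "C0 * R0 powr (1 - \<tau>) * L2_norm d \<Omega> v \<le> hnorm ip g * hnorm ip v"
    using v(4) cauchy_schwarz[OF assms(4) v(1)] by linarith
  also have "\<dots> \<le> hnorm ip g * (R0 * L2_norm d \<Omega> v)"
    using v(3) hnorm_nonneg[OF assms(4)] by (rule mult_left_mono)
  finally have "C0 * R0 powr (1 - \<tau>) \<le> hnorm ip g * R0"
    using v(2) by (simp add: mult.assoc[symmetric])
  moreover have "R0 powr (1 - \<tau>) = R0 * R0 powr (- \<tau>)"
    using assms(3) powr_add[of R0 1 "- \<tau>"] by simp
  ultimately show ?thesis using assms(3) by (simp add: mult.left_commute mult.commute)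
qed

text \<open>
  The Sobolev embedding, transferred to \<open>\<parallel>\<cdot>\<parallel>\<^sub>\<H>\<close> by the equivalence of norms.
\<close>

lemma sobolev_rkhs_evaluation_bounded:
  assumes "sobolev_rkhs d m \<Omega> K H ip"
  shows "\<exists>B\<ge>0. \<forall>v\<in>H. \<forall>z\<in>\<Omega>. \<bar>v z\<bar> \<le> B * hnorm ip v"
proof -
  define k where "k = (2 * pi) powr (- (real d / 2))
    * (((LINT \<xi>|leb d. (1 + dot d \<xi> \<xi>) powr (- m)) + 1) / 2)"
  have k: "0 \<le> k" unfolding k_def
    by (intro mult_nonneg_nonneg divide_nonneg_nonneg add_nonneg_nonneg
        Bochner_Integration.integral_nonneg) auto
  obtain a where a: "0 < a" "\<And>v. v \<in> H \<Longrightarrow> a * sobolev_norm d m \<Omega> v \<le> hnorm ip v"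
    using assms by (auto simp: sobolev_rkhs_def)
  have "\<bar>v z\<bar> \<le> k / a * hnorm ip v" if v: "v \<in> H" and z: "z \<in> \<Omega>" for v z
  proof -
    have "\<bar>v z\<bar> \<le> k * sobolev_norm d m \<Omega> v"
      unfolding k_def using assms v z by (intro sobolev_embedding) (auto simp: sobolev_rkhs_def)
    also have "\<dots> \<le> k * (hnorm ip v / a)"
      using a(1) a(2)[OF v] k by (intro mult_left_mono) (simp_all add: pos_le_divide_eq mult.commute)
    finally show ?thesis by simp
  qed
  then show ?thesis using k a(1) by (intro exI[of _ "k / a"]) auto
qed

lemma sobolev_rkhs_imp_euclidean_rkhs:
  "sobolev_rkhs d m \<Omega> K H ip \<Longrightarrow> euclidean_rkhs \<Omega> K H ip"
  unfolding sobolev_rkhs_def euclidean_rkhs_def by blast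


section \<open>Rates of the worst-case bias\<close>

theorem theorem4:
  fixes C0 C1 Cg Ceps R0 \<delta> \<tau> :: real
  assumes "0 < C0" "0 < C1" "0 < Cg" "0 < Ceps" "0 < R0"
    and "0 < \<delta>" "\<delta> \<le> 1" "0 < \<tau>" "\<tau> \<le> 1"
  shows
    "(\<delta> < 1 \<longrightarrow>
       (\<exists>A1>0. \<exists>A2>0. \<exists>A3>0. \<exists>A4>0.
          \<forall>d m \<Omega> K H ip (M :: 'w measure) e \<sigma> X C \<epsilon> g.
            sobolev_rkhs d m \<Omega> K H ip \<and> iid_errors M e \<sigma> \<and> design M e d \<Omega> X \<and>
            norm_comparison M d m \<Omega> H ip X C1 C \<and> 0 < \<epsilon> \<and> C \<epsilon> = Ceps \<and>
            g \<in> H \<and> interpolation_bound d \<Omega> H ip g Cg \<delta> \<and> growth_bound d \<Omega> H ip g C0 R0 \<tau> \<longrightarrow>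
            (\<forall>n\<ge>1. \<forall>w\<in>Xi_event M d m \<Omega> H ip X C1 (C \<epsilon>) n. \<forall>lam>0.
               A1 * real n powr (- (2 * m / real d)) \<le> lam \<and> lam \<le> A2 \<longrightarrow>
               ereal (A3 * lam powr ((2*\<tau> - 2*\<delta> + \<delta>\<^sup>2 - \<delta>\<^sup>2 * \<tau>) / (2 * \<tau> * (1 - \<delta>))))
                 \<le> sup_bias M e H ip g n lam (\<lambda>i. X n i w) \<and>
               (\<delta> = \<tau> \<longrightarrow>
                  ereal (A3 * lam powr (\<delta> / 2)) \<le> sup_bias M e H ip g n lam (\<lambda>i. X n i w) \<and>
                  sup_bias M e H ip g n lam (\<lambda>i. X n i w) \<le> ereal (A4 * lam powr (\<delta> / 2))))))
     \<and>
     (\<delta> = 1 \<longrightarrow>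
       (\<exists>A1>0. \<exists>A2>0.
          \<forall>d m \<Omega> K H ip. sobolev_rkhs d m \<Omega> K H ip \<longrightarrow>
            (\<exists>A3>0. \<forall>(M :: 'w measure) e \<sigma> X C \<epsilon> g.
               iid_errors M e \<sigma> \<and> design M e d \<Omega> X \<and>
               norm_comparison M d m \<Omega> H ip X C1 C \<and> 0 < \<epsilon> \<and> C \<epsilon> = Ceps \<and>
               g \<in> H \<and> interpolation_bound d \<Omega> H ip g Cg \<delta> \<and> growth_bound d \<Omega> H ip g C0 R0 \<tau> \<longrightarrow>
               (\<forall>n\<ge>1. \<forall>w\<in>Xi_event M d m \<Omega> H ip X C1 (C \<epsilon>) n. \<forall>lam>0.
                  A1 * real n powr (- (2 * m / real d)) \<le> lam \<and> lam \<le> A2 \<longrightarrow>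
                  ereal (A3 * lam) \<le> sup_bias M e H ip g n lam (\<lambda>i. X n i w)))))"
proof (intro conjI impI)
  assume \<delta>: "\<delta> < 1"
  (* A1 makes Ceps n^(-m/d) at most the square root of lam; A2 makes lam^(-1/2) at least R0
     and allows exponents of lam to be compared. *)
  define A1 A2 A4 where "A1 = Ceps\<^sup>2" and "A2 = min 1 (R0 powr (-2))" and "A4 = Cg * (1 + C1) powr \<delta>"
  define A3 where "A3 = ((C0 / (2 + C1)) powr (2 - \<delta>) / (Cg * (1 + C1) powr \<delta>)) powr (1 / (1 - \<delta>))"
  have A: "0 < A1" "0 < A2" "0 < A3" "0 < A4"
    using assms by (auto simp: A1_def A2_def A3_def A4_def)
  have p: "(2*\<tau> - 2*\<delta> + \<delta>\<^sup>2 - \<delta>\<^sup>2 * \<tau>) / (2 * \<tau> * (1 - \<delta>)) = \<delta> / 2" if "\<delta> = \<tau>"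
    unfolding that[symmetric] using assms(6) \<delta> by (simp add: field_simps power2_eq_square)
  show "\<exists>A1>0. \<exists>A2>0. \<exists>A3>0. \<exists>A4>0.
          \<forall>d m \<Omega> K H ip (M :: 'w measure) e \<sigma> X C \<epsilon> g.
            sobolev_rkhs d m \<Omega> K H ip \<and> iid_errors M e \<sigma> \<and> design M e d \<Omega> X \<and>
            norm_comparison M d m \<Omega> H ip X C1 C \<and> 0 < \<epsilon> \<and> C \<epsilon> = Ceps \<and>
            g \<in> H \<and> interpolation_bound d \<Omega> H ip g Cg \<delta> \<and> growth_bound d \<Omega> H ip g C0 R0 \<tau> \<longrightarrow>
            (\<forall>n\<ge>1. \<forall>w\<in>Xi_event M d m \<Omega> H ip X C1 (C \<epsilon>) n. \<forall>lam>0.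
               A1 * real n powr (- (2 * m / real d)) \<le> lam \<and> lam \<le> A2 \<longrightarrow>
               ereal (A3 * lam powr ((2*\<tau> - 2*\<delta> + \<delta>\<^sup>2 - \<delta>\<^sup>2 * \<tau>) / (2 * \<tau> * (1 - \<delta>))))
                 \<le> sup_bias M e H ip g n lam (\<lambda>i. X n i w) \<and>
               (\<delta> = \<tau> \<longrightarrow>
                  ereal (A3 * lam powr (\<delta> / 2)) \<le> sup_bias M e H ip g n lam (\<lambda>i. X n i w) \<and>
                  sup_bias M e H ip g n lam (\<lambda>i. X n i w) \<le> ereal (A4 * lam powr (\<delta> / 2))))"
  proof (rule exI[of _ A1], rule conjI[OF A(1)], rule exI[of _ A2], rule conjI[OF A(2)],
      rule exI[of _ A3], rule conjI[OF A(3)], rule exI[of _ A4], rule conjI[OF A(4)],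
      intro allI impI ballI, elim conjE)
    fix d m \<Omega> K H ip and M :: "'w measure" and e \<sigma> X C \<epsilon> g n w and lam :: real
    assume S: "sobolev_rkhs d m \<Omega> K H ip" and iid: "iid_errors M e \<sigma>" and D: "design M e d \<Omega> X"
      and C: "C \<epsilon> = Ceps" and g: "g \<in> H" "interpolation_bound d \<Omega> H ip g Cg \<delta>"
        "growth_bound d \<Omega> H ip g C0 R0 \<tau>"
      and n: "1 \<le> n" and w: "w \<in> Xi_event M d m \<Omega> H ip X C1 (C \<epsilon>) n"
      and lam: "0 < lam" "A1 * real n powr (- (2 * m / real d)) \<le> lam" "lam \<le> A2"
    interpret euclidean_rkhs \<Omega> K H ip by (rule sobolev_rkhs_imp_euclidean_rkhs[OF S])
    define \<rho> where "\<rho> = Ceps * real n powr (- (m / real d))"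
    have "\<rho>\<^sup>2 = A1 * real n powr (- (2 * m / real d))"
      using n by (simp add: \<rho>_def A1_def power_mult_distrib powr_power mult.commute)
    then have rho: "\<rho> \<le> sqrt lam" using lam(2) by (intro real_le_rsqrt) simp
    have x: "X n i w \<in> \<Omega>" if "i < n" for i
      using D w that by (auto simp: design_def Xi_event_def)
    have cmp: "L2_norm d \<Omega> v \<le> max (C1 * emp_norm n (\<lambda>i. X n i w) v) (\<rho> * hnorm ip v)"
      "emp_norm n (\<lambda>i. X n i w) v \<le> max (C1 * L2_norm d \<Omega> v) (\<rho> * hnorm ip v)" if "v \<in> H" for v
      using w that C by (auto simp: Xi_event_def \<rho>_def)
    have l: "lam \<le> 1" "lam \<le> R0 powr (-2)" using lam(3) by (auto simp: A2_def)
    have "ereal (A3 * lam powr ((2*\<tau> - 2*\<delta> + \<delta>\<^sup>2 - \<delta>\<^sup>2 * \<tau>) / (2 * \<tau> * (1 - \<delta>))))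
        \<le> sup_bias M e H ip g n lam (\<lambda>i. X n i w)
      \<and> sup_bias M e H ip g n lam (\<lambda>i. X n i w) \<le> ereal (A4 * lam powr (\<delta> / 2))"
      using sup_bias_bounds[OF iid x g assms(1-3,5,6) \<delta> assms(9) lam(1) l rho cmp]
      unfolding A3_def A4_def by blast
    then show "ereal (A3 * lam powr ((2*\<tau> - 2*\<delta> + \<delta>\<^sup>2 - \<delta>\<^sup>2 * \<tau>) / (2 * \<tau> * (1 - \<delta>))))
          \<le> sup_bias M e H ip g n lam (\<lambda>i. X n i w) \<and>
        (\<delta> = \<tau> \<longrightarrow>
          ereal (A3 * lam powr (\<delta> / 2)) \<le> sup_bias M e H ip g n lam (\<lambda>i. X n i w) \<and>
          sup_bias M e H ip g n lam (\<lambda>i. X n i w) \<le> ereal (A4 * lam powr (\<delta> / 2)))"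
      using p by metis
  qed
next
  assume "\<delta> = 1"
  have space: "\<exists>A3>0. \<forall>(M :: 'w measure) e \<sigma> X C \<epsilon> g.
               iid_errors M e \<sigma> \<and> design M e d \<Omega> X \<and>
               norm_comparison M d m \<Omega> H ip X C1 C \<and> 0 < \<epsilon> \<and> C \<epsilon> = Ceps \<and>
               g \<in> H \<and> interpolation_bound d \<Omega> H ip g Cg \<delta> \<and> growth_bound d \<Omega> H ip g C0 R0 \<tau> \<longrightarrow>
               (\<forall>n\<ge>1. \<forall>w\<in>Xi_event M d m \<Omega> H ip X C1 (C \<epsilon>) n. \<forall>lam>0.
                  1 * real n powr (- (2 * m / real d)) \<le> lam \<and> lam \<le> 1 \<longrightarrow>
                  ereal (A3 * lam) \<le> sup_bias M e H ip g n lam (\<lambda>i. X n i w))"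
    if S: "sobolev_rkhs d m \<Omega> K H ip" for d m \<Omega> K H ip
  proof -
    interpret euclidean_rkhs \<Omega> K H ip by (rule sobolev_rkhs_imp_euclidean_rkhs[OF S])
    obtain B where B: "0 \<le> B" "\<And>v z. v \<in> H \<Longrightarrow> z \<in> \<Omega> \<Longrightarrow> \<bar>v z\<bar> \<le> B * hnorm ip v"
      using sobolev_rkhs_evaluation_bounded[OF S] by blast
    define A3 where "A3 = C0 * R0 powr (- \<tau>) / (B\<^sup>2 + 1)"
    have A3: "0 < A3" using assms(1,5) by (simp add: A3_def add_nonneg_pos)
    show ?thesis
    proof (rule exI[of _ A3], rule conjI[OF A3], intro allI impI ballI, elim conjE)
      fix M :: "'w measure" and e \<sigma> X C \<epsilon> g n w and lam :: real
      assume iid: "iid_errors M e \<sigma>" and D: "design M e d \<Omega> X" and g: "g \<in> H"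
        "growth_bound d \<Omega> H ip g C0 R0 \<tau>"
        and n: "1 \<le> n" and w: "w \<in> Xi_event M d m \<Omega> H ip X C1 (C \<epsilon>) n"
        and lam: "0 < lam" "lam \<le> 1"
      have x: "X n i w \<in> \<Omega>" if "i < n" for i
        using D w that by (auto simp: design_def Xi_event_def)
      have "A3 * lam = lam * (C0 * R0 powr (- \<tau>)) / (B\<^sup>2 + 1)" by (simp add: A3_def)
      also have "\<dots> \<le> lam * hnorm ip g / (B\<^sup>2 + lam)"
        using hnorm_ge_of_growth_bound[OF g(2) assms(1,5) g(1)] hnorm_nonneg[OF g(1)] lam
        by (intro frac_le mult_left_mono mult_nonneg_nonneg) (auto simp: add_nonneg_pos)
      finally have "ereal (A3 * lam) \<le> ereal (lam * hnorm ip g / (B\<^sup>2 + lam))" by simp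
      also have "\<dots> \<le> sup_bias M e H ip g n lam (\<lambda>i. X n i w)"
        by (rule sup_bias_ge_of_bounded_evaluation[OF iid lam(1) x g(1) n B(2,1)])
      finally show "ereal (A3 * lam) \<le> sup_bias M e H ip g n lam (\<lambda>i. X n i w)" .
    qed
  qed
  show "\<exists>A1>0. \<exists>A2>0.
          \<forall>d m \<Omega> K H ip. sobolev_rkhs d m \<Omega> K H ip \<longrightarrow>
            (\<exists>A3>0. \<forall>(M :: 'w measure) e \<sigma> X C \<epsilon> g.
               iid_errors M e \<sigma> \<and> design M e d \<Omega> X \<and>
               norm_comparison M d m \<Omega> H ip X C1 C \<and> 0 < \<epsilon> \<and> C \<epsilon> = Ceps \<and>
               g \<in> H \<and> interpolation_bound d \<Omega> H ip g Cg \<delta> \<and> growth_bound d \<Omega> H ip g C0 R0 \<tau> \<longrightarrow>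
               (\<forall>n\<ge>1. \<forall>w\<in>Xi_event M d m \<Omega> H ip X C1 (C \<epsilon>) n. \<forall>lam>0.
                  A1 * real n powr (- (2 * m / real d)) \<le> lam \<and> lam \<le> A2 \<longrightarrow>
                  ereal (A3 * lam) \<le> sup_bias M e H ip g n lam (\<lambda>i. X n i w)))"
    by (rule exI[of _ 1], rule conjI[OF zero_less_one], rule exI[of _ 1],
        rule conjI[OF zero_less_one], intro allI impI, rule space)
qed

end
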